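(* Let $\varphi(x,y,z)$ be any $\Sigma$-formula of first-order arithmetic that defines the (non-hereditary) Goodstein sequences, in the sense that for all $i,k,n\in\mathbb N$ $$G_n(i)=k\quad\Longleftrightarrow\quad\mathbb N\vDash\varphi(n,i,k).$$ Then $\mathsf{I\Sigma}_1\nvdash\forall x\,\exists y\,\varphi(x,y,0)$. That is, the termination of non-hereditary Goodstein sequences is unprovable in $\mathsf{I\Sigma}_1$.
   Context: Base-$b$ normal form: for $b\ge 2$ and $n>0$, write $n=_{b\text{-}\mathsf{NF}}b^{e_0}\cdot c_0+\ldots+b^{e_k}\cdot c_k$ if equality holds, $e_0>\ldots>e_k$ and $0<c_i<b$ for all $i\le k$. Each $n>0$ has a unique such form. Goodstein sequence with start value $n\in\mathbb N$: the function $G_n:\mathbb N\to\mathbb N$ with $G_n(0)=n$ and: if $G_n(i)=0$ then $G_n(i+1)=0$; if $0<G_n(i)=_{(i+2)\text{-}\mathsf{NF}}(i+2)^{e_0}\cdot c_0+\ldots+(i+2)^{e_k}\cdot c_k$, then $G_n(i+1)=(i+3)^{e_0}\cdot c_0+\ldots+(i+3)^{e_k}\cdot c_k-1$ (exponents are not rewritten in normal form). The sequence terminates if $G_n(i)=0$ for some $i$. First-order arithmetic has the signature $0$ (constant), $S$ (unary function), $+,\times$ (binary functions), $=,\le$ (binary relations); $\mathbb N$ also denotes the standard model. Formulas are in negation normal form (negation only in front of atomic formulas; $\varphi\to\psi$ abbreviates $\neg\varphi\lor\psi$, with negation pushed to the atoms by the de Morgan laws). $\Sigma$-formulas: generated from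 literals (atomic formulas and negated atomic formulas) by $\land$, $\lor$, bounded quantifiers $\forall x(x\le t\to\varphi)$ and $\exists x(x\le t\land\varphi)$ with $t$ a term in which $x$ does not occur, and unbounded existential quantifiers $\exists x\,\varphi$. A bounded formula is one generated without unbounded existential quantifiers. A $\Sigma_1$-formula is one of the form $\exists x\,\theta$ with $\theta$ bounded. Robinson arithmetic $\mathsf Q$ consists of the equality axioms and the universal closures of: $Sx=Sy\to x=y$; $x\ne 0\leftrightarrow\exists y\,x=Sy$; $x\le y\leftrightarrow\exists z\,z+x=y$; $x+0=x$; $x+Sy=S(x+y)$; $x\times 0=0$; $x\times Sy=(x\times y)+x$. The theory $\mathsf{I\Sigma}_1$ consists of $\mathsf Q$ together with, for every $\Sigma_1$-formula $\varphi(x)$ (possibly with further free variables as parameters), the universal closure of $\varphi(0)\land\forall x(\varphi(x)\to\varphi(Sx))\to\forall x\,\varphi(x)$. $\mathsf T\vdash\psi$ is provability in classical first-order logic. *)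

theory Defs
  imports Main
begin

section \<open>Base-\<open>b\<close> normal forms and Goodstein sequences\<close>

text \<open>The list \<open>[(e\<^sub>0, c\<^sub>0), \<dots>, (e\<^sub>k, c\<^sub>k)]\<close> stands for the sum of the \<open>b ^ e\<^sub>i * c\<^sub>i\<close>.\<close>

definition base_sum :: "nat \<Rightarrow> (nat \<times> nat) list \<Rightarrow> nat" where
  "base_sum b ecs = (\<Sum>(e, c)\<leftarrow>ecs. b ^ e * c)"

definition is_base_nf :: "nat \<Rightarrow> nat \<Rightarrow> (nat \<times> nat) list \<Rightarrow> bool" where
  "is_base_nf b n ecs \<longleftrightarrow>
     n = base_sum b ecs \<and> sorted_wrt (>) (map fst ecs) \<and> (\<forall>(e, c) \<in> set ecs. 0 < c \<and> c < b)"

definition base_nf :: "nat \<Rightarrow> nat \<Rightarrow> (nat \<times> nat) list" where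
  "base_nf b n = (THE ecs. is_base_nf b n ecs)"

fun goodstein :: "nat \<Rightarrow> nat \<Rightarrow> nat" where
  "goodstein n 0 = n"
| "goodstein n (Suc i) =
     (if goodstein n i = 0 then 0
      else base_sum (i + 3) (base_nf (i + 2) (goodstein n i)) - 1)"

text \<open>The description in \<^const>\<open>base_nf\<close> is proper: normal forms exist and are unique.\<close>

lemma base_sum_simps [simp]:
  "base_sum b [] = 0"
  "base_sum b ((e, c) # ecs) = b ^ e * c + base_sum b ecs"
  by (simp_all add: base_sum_def)

lemma base_sum_less:
  assumes "sorted_wrt (>) (map fst ecs)" "\<forall>(e, c) \<in> set ecs. 0 < c \<and> c < b"
    "\<forall>(e, c) \<in> set ecs. e < m" "b \<ge> 2"
  shows "base_sum b ecs < b ^ m"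
  using assms
proof (induction ecs arbitrary: m)
  case Nil
  then show ?case by simp
next
  case (Cons p ecs)
  obtain e c where p: "p = (e, c)" by force
  have "base_sum b ecs < b ^ e"
    using Cons.prems by (intro Cons.IH) (auto simp: p)
  then have "base_sum b (p # ecs) < b ^ e * (c + 1)"
    by (simp add: p)
  also have "\<dots> \<le> b ^ e * b"
    using Cons.prems by (intro mult_le_mono2) (auto simp: p)
  also have "\<dots> = b ^ Suc e" by simp
  also have "\<dots> \<le> b ^ m"
    using Cons.prems by (intro power_increasing) (auto simp: p)
  finally show ?case .
qed

lemma is_base_nf_Cons:
  assumes "is_base_nf b n ((e, c) # ecs)" "b \<ge> 2"
  shows "b ^ e \<le> n" "n < b ^ Suc e" "n div b ^ e = c" "is_base_nf b (n mod b ^ e) ecs"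
proof -
  have n: "n = b ^ e * c + base_sum b ecs" and c: "0 < c" "c < b"
    and lt: "base_sum b ecs < b ^ e"
    using assms by (auto simp: is_base_nf_def intro!: base_sum_less)
  have "b ^ e * 1 \<le> b ^ e * c"
    using c by (intro mult_le_mono2) auto
  then show "b ^ e \<le> n" using n by linarith
  have "n < b ^ e * (c + 1)" using n lt by simp
  also have "\<dots> \<le> b ^ e * b"
    using c by (intro mult_le_mono2) auto
  finally show "n < b ^ Suc e" by (simp add: mult.commute)
  show "n div b ^ e = c" unfolding n using lt
    by (intro div_nat_eqI) (simp_all add: algebra_simps)
  have "n mod b ^ e = base_sum b ecs" unfolding n using lt by simp
  then show "is_base_nf b (n mod b ^ e) ecs"
    using assms by (auto simp: is_base_nf_def)
qed

lemma is_base_nf_unique: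
  assumes "is_base_nf b n ecs" "is_base_nf b n ecs'" "b \<ge> 2"
  shows "ecs = ecs'"
  using assms
proof (induction ecs arbitrary: n ecs')
  case Nil
  then have "n = 0" by (simp add: is_base_nf_def)
  then show ?case
    using Nil is_base_nf_Cons(1)[of b n] by (cases ecs') auto
next
  case (Cons p ecs)
  obtain e c where p: "p = (e, c)" by force
  note nf = is_base_nf_Cons[OF Cons.prems(1)[unfolded p] Cons.prems(3)]
  show ?case
  proof (cases ecs')
    case Nil
    then have "n = 0" using Cons.prems by (simp add: is_base_nf_def)
    then show ?thesis using nf(1) Cons.prems(3) by simp
  next
    case (Cons p' ds)
    obtain e' c' where p': "p' = (e', c')" by force
    note nf' = is_base_nf_Cons[OF \<open>is_base_nf b n ecs'\<close>[unfolded Cons p'] \<open>b \<ge> 2\<close>]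
    have b: "1 < b" using \<open>b \<ge> 2\<close> by simp
    have "e < Suc e'" "e' < Suc e"
      using power_less_imp_less_exp[OF b le_less_trans[OF nf(1) nf'(2)]]
        power_less_imp_less_exp[OF b le_less_trans[OF nf'(1) nf(2)]] .
    then have "e = e'" by simp
    then show ?thesis
      using nf(3,4) nf'(3,4) Cons.IH[of "n mod b ^ e" ds] Cons \<open>b \<ge> 2\<close>
      by (simp add: p p')
  qed
qed

lemma is_base_nf_exists:
  assumes "b \<ge> 2"
  shows "\<exists>ecs. is_base_nf b n ecs"
proof (induction n rule: less_induct)
  case (less n)
  show ?case
  proof (cases "n = 0")
    case True
    then have "is_base_nf b n []" by (simp add: is_base_nf_def)
    then show ?thesis ..
  next
    case False
    have bound: "e \<le> n" if "b ^ e \<le> n" for e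
    proof -
      have "e < 2 ^ e" by (rule less_exp)
      also have "\<dots> \<le> b ^ e" using assms by (rule power_mono) simp
      finally show ?thesis using that by linarith
    qed
    have "\<exists>e. b ^ e \<le> n" using False by (intro exI[of _ 0]) simp
    then obtain e where e: "b ^ e \<le> n" and max: "\<forall>e'. b ^ e' \<le> n \<longrightarrow> e' \<le> e"
      using ex_has_greatest_nat[of "\<lambda>e. b ^ e \<le> n" _ "\<lambda>e. e" "Suc n"] bound
      by (metis le_imp_less_Suc)
    have upper: "n < b ^ Suc e" using max by (metis Suc_n_not_le_n not_le)
    have pos: "0 < b ^ e" using assms by simp
    then have "n mod b ^ e < n"
      using e by (meson less_le_trans mod_less_divisor)
    then obtain ecs where ecs: "is_base_nf b (n mod b ^ e) ecs"
      using less by blast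
    have small: "e' < e" if "(e', c') \<in> set ecs" for e' c'
    proof -
      have "b ^ e' * c' \<in> set (map (\<lambda>(e, c). b ^ e * c) ecs)"
        using that by force
      then have "b ^ e' * c' \<le> base_sum b ecs"
        unfolding base_sum_def
        by (intro member_le_sum_list) auto
      moreover have "base_sum b ecs = n mod b ^ e" "0 < c'"
        using ecs that by (auto simp: is_base_nf_def)
      moreover have "b ^ e' * 1 \<le> b ^ e' * c'"
        using \<open>0 < c'\<close> by (intro mult_le_mono2) simp
      ultimately have "b ^ e' \<le> n mod b ^ e" by linarith
      also have "\<dots> < b ^ e" using pos by simp
      finally have "b ^ e' < b ^ e" .
      moreover have "1 < b" using assms by simp
      ultimately show ?thesis using power_less_imp_less_exp by blast
    qed
    have c: "0 < n div b ^ e" "n div b ^ e < b"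
      using e upper pos by (auto simp: div_greater_zero_iff less_mult_imp_div_less mult.commute)
    have "n = b ^ e * (n div b ^ e) + base_sum b ecs"
      using ecs mult_div_mod_eq[of "b ^ e" n] by (simp add: is_base_nf_def)
    then have "is_base_nf b n ((e, n div b ^ e) # ecs)"
      using ecs c small by (auto simp: is_base_nf_def simp del: mult_div_mod_eq)
    then show ?thesis ..
  qed
qed

lemma is_base_nf_base_nf:
  assumes "b \<ge> 2"
  shows "is_base_nf b n (base_nf b n)"
proof -
  have "\<exists>!ecs. is_base_nf b n ecs"
    using is_base_nf_exists[OF assms] is_base_nf_unique[OF _ _ assms] by (rule ex_ex1I)
  then show ?thesis unfolding base_nf_def by (rule theI')
qed


section \<open>First-order arithmetic\<close>

text \<open>Variables are de Bruijn indices, and formulas are in negation normal form.\<close>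

datatype trm =
    Var nat
  | Zero
  | Succ trm
  | Plus trm trm
  | Times trm trm

datatype atm =
    Eq trm trm
  | Le trm trm

datatype fm =
    Atom atm
  | NegAtom atm
  | And fm fm
  | Or fm fm
  | Forall fm
  | Exists fm

primrec neg :: "fm \<Rightarrow> fm" where
  "neg (Atom a) = NegAtom a"
| "neg (NegAtom a) = Atom a"
| "neg (And \<phi> \<psi>) = Or (neg \<phi>) (neg \<psi>)"
| "neg (Or \<phi> \<psi>) = And (neg \<phi>) (neg \<psi>)"
| "neg (Forall \<phi>) = Exists (neg \<phi>)"
| "neg (Exists \<phi>) = Forall (neg \<phi>)"

abbreviation Imp :: "fm \<Rightarrow> fm \<Rightarrow> fm" where
  "Imp \<phi> \<psi> \<equiv> Or (neg \<phi>) \<psi>"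

abbreviation Iff :: "fm \<Rightarrow> fm \<Rightarrow> fm" where
  "Iff \<phi> \<psi> \<equiv> And (Imp \<phi> \<psi>) (Imp \<psi> \<phi>)"

text \<open>\<open>a ;; s\<close> is the sequence \<open>a, s 0, s 1, \<dots>\<close>; it is used both for variable assignments and
  for simultaneous substitutions.\<close>

abbreviation scons :: "'a \<Rightarrow> (nat \<Rightarrow> 'a) \<Rightarrow> nat \<Rightarrow> 'a" (infixr \<open>;;\<close> 65) where
  "a ;; s \<equiv> case_nat a s"

primrec subst_trm :: "(nat \<Rightarrow> trm) \<Rightarrow> trm \<Rightarrow> trm" where
  "subst_trm \<sigma> (Var i) = \<sigma> i"
| "subst_trm \<sigma> Zero = Zero"
| "subst_trm \<sigma> (Succ t) = Succ (subst_trm \<sigma> t)"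
| "subst_trm \<sigma> (Plus s t) = Plus (subst_trm \<sigma> s) (subst_trm \<sigma> t)"
| "subst_trm \<sigma> (Times s t) = Times (subst_trm \<sigma> s) (subst_trm \<sigma> t)"

abbreviation lift_trm :: "trm \<Rightarrow> trm" where
  "lift_trm \<equiv> subst_trm (\<lambda>i. Var (Suc i))"

primrec subst_atm :: "(nat \<Rightarrow> trm) \<Rightarrow> atm \<Rightarrow> atm" where
  "subst_atm \<sigma> (Eq s t) = Eq (subst_trm \<sigma> s) (subst_trm \<sigma> t)"
| "subst_atm \<sigma> (Le s t) = Le (subst_trm \<sigma> s) (subst_trm \<sigma> t)"

primrec subst :: "(nat \<Rightarrow> trm) \<Rightarrow> fm \<Rightarrow> fm" where
  "subst \<sigma> (Atom a) = Atom (subst_atm \<sigma> a)"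
| "subst \<sigma> (NegAtom a) = NegAtom (subst_atm \<sigma> a)"
| "subst \<sigma> (And \<phi> \<psi>) = And (subst \<sigma> \<phi>) (subst \<sigma> \<psi>)"
| "subst \<sigma> (Or \<phi> \<psi>) = Or (subst \<sigma> \<phi>) (subst \<sigma> \<psi>)"
| "subst \<sigma> (Forall \<phi>) = Forall (subst (Var 0 ;; (\<lambda>i. lift_trm (\<sigma> i))) \<phi>)"
| "subst \<sigma> (Exists \<phi>) = Exists (subst (Var 0 ;; (\<lambda>i. lift_trm (\<sigma> i))) \<phi>)"

abbreviation lift :: "fm \<Rightarrow> fm" where
  "lift \<equiv> subst (\<lambda>i. Var (Suc i))"

text \<open>The level is the least \<open>n\<close> such that all free variables are among \<open>Var 0, \<dots>, Var (n - 1)\<close>;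
  sentences are the formulas of level \<open>0\<close>.\<close>

primrec level_trm :: "trm \<Rightarrow> nat" where
  "level_trm (Var i) = Suc i"
| "level_trm Zero = 0"
| "level_trm (Succ t) = level_trm t"
| "level_trm (Plus s t) = max (level_trm s) (level_trm t)"
| "level_trm (Times s t) = max (level_trm s) (level_trm t)"

primrec level_atm :: "atm \<Rightarrow> nat" where
  "level_atm (Eq s t) = max (level_trm s) (level_trm t)"
| "level_atm (Le s t) = max (level_trm s) (level_trm t)"

primrec level :: "fm \<Rightarrow> nat" where
  "level (Atom a) = level_atm a"
| "level (NegAtom a) = level_atm a"
| "level (And \<phi> \<psi>) = max (level \<phi>) (level \<psi>)"
| "level (Or \<phi> \<psi>) = max (level \<phi>) (level \<psi>)"
| "level (Forall \<phi>) = level \<phi> - 1"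
| "level (Exists \<phi>) = level \<phi> - 1"

definition univ_closure :: "fm \<Rightarrow> fm" where
  "univ_closure \<phi> = (Forall ^^ level \<phi>) \<phi>"


section \<open>The standard model\<close>

primrec val :: "(nat \<Rightarrow> nat) \<Rightarrow> trm \<Rightarrow> nat" where
  "val e (Var i) = e i"
| "val e Zero = 0"
| "val e (Succ t) = Suc (val e t)"
| "val e (Plus s t) = val e s + val e t"
| "val e (Times s t) = val e s * val e t"

primrec sat_atm :: "(nat \<Rightarrow> nat) \<Rightarrow> atm \<Rightarrow> bool" where
  "sat_atm e (Eq s t) \<longleftrightarrow> val e s = val e t"
| "sat_atm e (Le s t) \<longleftrightarrow> val e s \<le> val e t"

primrec sat :: "(nat \<Rightarrow> nat) \<Rightarrow> fm \<Rightarrow> bool" where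
  "sat e (Atom a) \<longleftrightarrow> sat_atm e a"
| "sat e (NegAtom a) \<longleftrightarrow> \<not> sat_atm e a"
| "sat e (And \<phi> \<psi>) \<longleftrightarrow> sat e \<phi> \<and> sat e \<psi>"
| "sat e (Or \<phi> \<psi>) \<longleftrightarrow> sat e \<phi> \<or> sat e \<psi>"
| "sat e (Forall \<phi>) \<longleftrightarrow> (\<forall>a. sat (a ;; e) \<phi>)"
| "sat e (Exists \<phi>) \<longleftrightarrow> (\<exists>a. sat (a ;; e) \<phi>)"


section \<open>Classes of formulas\<close>

text \<open>In a bounded quantifier the bounding term is lifted, so the bound variable does not occur
  in it.\<close>

abbreviation AllLe :: "trm \<Rightarrow> fm \<Rightarrow> fm" where
  "AllLe t \<phi> \<equiv> Forall (Imp (Atom (Le (Var 0) (lift_trm t))) \<phi>)"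

abbreviation ExLe :: "trm \<Rightarrow> fm \<Rightarrow> fm" where
  "ExLe t \<phi> \<equiv> Exists (And (Atom (Le (Var 0) (lift_trm t))) \<phi>)"

inductive bounded_fm :: "fm \<Rightarrow> bool" where
  "bounded_fm (Atom a)"
| "bounded_fm (NegAtom a)"
| "bounded_fm \<phi> \<Longrightarrow> bounded_fm \<psi> \<Longrightarrow> bounded_fm (And \<phi> \<psi>)"
| "bounded_fm \<phi> \<Longrightarrow> bounded_fm \<psi> \<Longrightarrow> bounded_fm (Or \<phi> \<psi>)"
| "bounded_fm \<phi> \<Longrightarrow> bounded_fm (AllLe t \<phi>)"
| "bounded_fm \<phi> \<Longrightarrow> bounded_fm (ExLe t \<phi>)"

inductive sigma_fm :: "fm \<Rightarrow> bool" where
  "sigma_fm (Atom a)"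
| "sigma_fm (NegAtom a)"
| "sigma_fm \<phi> \<Longrightarrow> sigma_fm \<psi> \<Longrightarrow> sigma_fm (And \<phi> \<psi>)"
| "sigma_fm \<phi> \<Longrightarrow> sigma_fm \<psi> \<Longrightarrow> sigma_fm (Or \<phi> \<psi>)"
| "sigma_fm \<phi> \<Longrightarrow> sigma_fm (AllLe t \<phi>)"
| "sigma_fm \<phi> \<Longrightarrow> sigma_fm (ExLe t \<phi>)"
| "sigma_fm \<phi> \<Longrightarrow> sigma_fm (Exists \<phi>)"

definition sigma1_fm :: "fm \<Rightarrow> bool" where
  "sigma1_fm \<phi> \<longleftrightarrow> (\<exists>\<theta>. bounded_fm \<theta> \<and> \<phi> = Exists \<theta>)"


section \<open>Provability in classical first-order logic\<close>

text \<open>A one-sided sequent calculus with cut. A sequent is read as the disjunction of its members;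
  \<open>T\<close> is meant to be a set of sentences. In the rule for the universal quantifier, lifting the
  side formulas makes \<open>Var 0\<close> a fresh eigenvariable. Equality is not treated as a logical
  symbol; its axioms belong to \<open>T\<close>.\<close>

inductive derivable :: "fm set \<Rightarrow> fm list \<Rightarrow> bool" for T :: "fm set" where
  Axiom: "derivable T [Atom a, NegAtom a]"
| Theory: "\<phi> \<in> T \<Longrightarrow> derivable T [\<phi>]"
| AndI: "derivable T (\<phi> # \<Gamma>) \<Longrightarrow> derivable T (\<psi> # \<Gamma>) \<Longrightarrow> derivable T (And \<phi> \<psi> # \<Gamma>)"
| OrI: "derivable T (\<phi> # \<psi> # \<Gamma>) \<Longrightarrow> derivable T (Or \<phi> \<psi> # \<Gamma>)"
| AllI: "derivable T (\<phi> # map lift \<Gamma>) \<Longrightarrow> derivable T (Forall \<phi> # \<Gamma>)"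
| ExI: "derivable T (subst (t ;; Var) \<phi> # \<Gamma>) \<Longrightarrow> derivable T (Exists \<phi> # \<Gamma>)"
| Cut: "derivable T (\<phi> # \<Gamma>) \<Longrightarrow> derivable T (neg \<phi> # \<Gamma>) \<Longrightarrow> derivable T \<Gamma>"
| Structural: "derivable T \<Gamma> \<Longrightarrow> set \<Gamma> \<subseteq> set \<Delta> \<Longrightarrow> derivable T \<Delta>"

definition proves :: "fm set \<Rightarrow> fm \<Rightarrow> bool" (infix \<open>\<turnstile>\<close> 50) where
  "T \<turnstile> \<phi> \<longleftrightarrow> derivable T [\<phi>]"


section \<open>Robinson arithmetic and \<open>\<Sigma>\<^sub>1\<close>-induction\<close>

abbreviation EqF :: "trm \<Rightarrow> trm \<Rightarrow> fm" (infix \<open>\<doteq>\<close> 60) where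
  "s \<doteq> t \<equiv> Atom (Eq s t)"

abbreviation LeF :: "trm \<Rightarrow> trm \<Rightarrow> fm" (infix \<open>\<preceq>\<close> 60) where
  "s \<preceq> t \<equiv> Atom (Le s t)"

definition equality_axioms :: "fm set" where
  "equality_axioms = univ_closure ` {
     Var 0 \<doteq> Var 0,
     Imp (Var 0 \<doteq> Var 1) (Var 1 \<doteq> Var 0),
     Imp (And (Var 0 \<doteq> Var 1) (Var 1 \<doteq> Var 2)) (Var 0 \<doteq> Var 2),
     Imp (Var 0 \<doteq> Var 1) (Succ (Var 0) \<doteq> Succ (Var 1)),
     Imp (And (Var 0 \<doteq> Var 1) (Var 2 \<doteq> Var 3))
       (Plus (Var 0) (Var 2) \<doteq> Plus (Var 1) (Var 3)),
     Imp (And (Var 0 \<doteq> Var 1) (Var 2 \<doteq> Var 3))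
       (Times (Var 0) (Var 2) \<doteq> Times (Var 1) (Var 3)),
     Imp (And (Var 0 \<doteq> Var 1) (And (Var 2 \<doteq> Var 3) (Var 0 \<preceq> Var 2))) (Var 1 \<preceq> Var 3)}"

definition robinson_axioms :: "fm set" where
  "robinson_axioms = equality_axioms \<union> univ_closure ` {
     Imp (Succ (Var 0) \<doteq> Succ (Var 1)) (Var 0 \<doteq> Var 1),
     Iff (neg (Var 0 \<doteq> Zero)) (Exists (Var 1 \<doteq> Succ (Var 0))),
     Iff (Var 0 \<preceq> Var 1) (Exists (Plus (Var 0) (Var 1) \<doteq> Var 2)),
     Plus (Var 0) Zero \<doteq> Var 0,
     Plus (Var 0) (Succ (Var 1)) \<doteq> Succ (Plus (Var 0) (Var 1)),
     Times (Var 0) Zero \<doteq> Zero,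
     Times (Var 0) (Succ (Var 1)) \<doteq> Plus (Times (Var 0) (Var 1)) (Var 0)}"

text \<open>Induction on \<open>Var 0\<close>; the remaining free variables of \<open>\<phi>\<close> are parameters.\<close>

definition induction_fm :: "fm \<Rightarrow> fm" where
  "induction_fm \<phi> =
     Imp (And (subst (Zero ;; Var) \<phi>)
              (Forall (Imp \<phi> (subst (Succ (Var 0) ;; (\<lambda>i. Var (Suc i))) \<phi>))))
         (Forall \<phi>)"

definition ISigma1 :: "fm set" where
  "ISigma1 = robinson_axioms \<union> {univ_closure (induction_fm \<phi>) | \<phi>. sigma1_fm \<phi>}"

end

theory Submission
  imports Defs "HOL-Library.Countable"
begin

text \<open>The proof is the model-theoretic one of Kirby and Paris. Take an ultrapower of the standard
  model with respect to a free ultrafilter on \<open>\<nat>\<close>. Starting from \<open>3 * 2 ^ k\<close>, the Goodstein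
  sequence does not vanish before its base reaches \<open>ack k 2\<close> for the Ackermann hierarchy. Below
  \<open>ack (Suc k) 2\<close> with \<open>k\<close> infinite there is therefore room for a sequence of elements \<open>s 0 < s 1 < \<dots>\<close>
  such that, for parameters up to \<open>s i\<close>, no bounded formula has its least witness in the gap
  between \<open>s (i + 1)\<close> and the later terms: such gaps are found by the pigeonhole principle, since
  \<open>ack (Suc k)\<close> iterates \<open>ack k\<close> more often than there are formulas and parameters to consider.
  The cut \<open>D\<close> determined by the \<open>s i\<close> is a model of \<open>\<Sigma>\<^sub>1\<close>-induction, because a \<open>\<Sigma>\<^sub>1\<close>-formula is
  equivalent to a bounded one on each proper initial segment of \<open>D\<close>. As \<open>\<Sigma>\<close>-formulas persist from \<open>D\<close>
  to the ultrapower, a zero of the sequence witnessed in \<open>D\<close> would be a genuine one, but these lie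
  above \<open>D\<close>.\<close>

section \<open>Goodstein sequences and the Ackermann hierarchy\<close>

definition rebase :: "nat \<Rightarrow> nat \<Rightarrow> nat" where
  "rebase b n = base_sum (Suc b) (base_nf b n)"

lemma base_nf_eqI: "is_base_nf b n ecs \<Longrightarrow> b \<ge> 2 \<Longrightarrow> base_nf b n = ecs"
  using is_base_nf_unique is_base_nf_base_nf by blast

lemma base_sum_append: "base_sum b (xs @ ys) = base_sum b xs + base_sum b ys"
  by (simp add: base_sum_def)

lemma base_sum_shift:
  "base_sum b (map (\<lambda>(e, c). (Suc e, c)) ecs) = b * base_sum b ecs"
  by (induction ecs) (auto simp: algebra_simps)

lemma rebase_0 [simp]: "b \<ge> 2 \<Longrightarrow> rebase b 0 = 0"
  using base_nf_eqI[of b 0 "[]"] by (simp add: rebase_def is_base_nf_def)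

text \<open>Shifting the exponents in the normal form of \<open>n div b\<close> by one and appending
  the digit \<open>n mod b\<close> gives a normal form of \<open>n\<close>, and normal forms are
  unique. Base change can then be handled by division with remainder.\<close>

lemma rebase_rec:
  assumes "b \<ge> 2"
  shows "rebase b n = Suc b * rebase b (n div b) + n mod b"
proof -
  define ecs where "ecs = base_nf b (n div b)"
  \<comment> \<open>A zero remainder contributes no term, as coefficients in a normal form are
    positive.\<close>
  define low where "low = (if n mod b = 0 then [] else [(0::nat, n mod b)])"
  have nf: "is_base_nf b (n div b) ecs"
    unfolding ecs_def using assms by (rule is_base_nf_base_nf)
  have low: "base_sum b' low = n mod b" for b'
    by (simp add: low_def)
  have fst_shift: "map fst (map (\<lambda>(e, c). (Suc e, c)) ecs) = map Suc (map fst ecs)"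
    by (induction ecs) auto
  have "is_base_nf b n (map (\<lambda>(e, c). (Suc e, c)) ecs @ low)"
    unfolding is_base_nf_def
  proof (intro conjI)
    show "n = base_sum b (map (\<lambda>(e, c). (Suc e, c)) ecs @ low)"
      using nf mult_div_mod_eq[of b n] unfolding base_sum_append base_sum_shift low is_base_nf_def
      by metis
    have "sorted_wrt (>) (map Suc (map fst ecs))"
      using nf by (auto simp: is_base_nf_def sorted_wrt_map)
    then show "sorted_wrt (>) (map fst (map (\<lambda>(e, c). (Suc e, c)) ecs @ low))"
      unfolding map_append fst_shift by (auto simp: sorted_wrt_append low_def)
    show "\<forall>(e, c)\<in>set (map (\<lambda>(e, c). (Suc e, c)) ecs @ low). 0 < c \<and> c < b"
      using nf assms by (auto simp: is_base_nf_def low_def)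
  qed
  then show ?thesis
    using assms
    by (simp add: rebase_def base_nf_eqI base_sum_append base_sum_shift low ecs_def)
qed

text \<open>Equal quotients leave the comparison to the remainders. Otherwise the rebased quotients
  differ by at least 1, and the factor \<open>Suc b\<close> outweighs the remainder of
  \<open>x\<close>.\<close>

lemma rebase_strict_mono:
  assumes "b \<ge> 2" "x < y"
  shows "rebase b x < rebase b y"
  using assms(2)
proof (induction y arbitrary: x rule: less_induct)
  case (less y)
  have b: "0 < b" "1 < b" using assms by auto
  show ?case
  proof (cases "x div b = y div b")
    case True
    then have "x mod b < y mod b"
      using less.prems by (metis div_mult_mod_eq nat_add_left_cancel_less)
    then show ?thesis
      using assms(1) True by (simp add: rebase_rec[of b x] rebase_rec[of b y])
  next
    case False
    then have lt: "x div b < y div b"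
      using less.prems by (simp add: div_le_mono le_neq_implies_less)
    moreover have "y div b < y" using b less.prems by (intro div_less_dividend) auto
    ultimately have "Suc (rebase b (x div b)) \<le> rebase b (y div b)"
      using less.IH by (simp add: Suc_leI)
    then have "Suc b * Suc (rebase b (x div b)) \<le> Suc b * rebase b (y div b)"
      by (rule mult_le_mono2)
    moreover have "x mod b < Suc b" using b by (simp add: less_SucI)
    ultimately show ?thesis
      using rebase_rec[OF assms(1), of x] rebase_rec[OF assms(1), of y] by simp
  qed
qed

lemma rebase_mono: "b \<ge> 2 \<Longrightarrow> x \<le> y \<Longrightarrow> rebase b x \<le> rebase b y"
  using rebase_strict_mono[of b x y] by (cases "x = y") auto

text \<open>No case distinction remains: at 0 the base change gives 0, and subtraction is
  truncated.\<close>

lemma goodstein_Suc_rebase: "goodstein n (Suc i) = rebase (i + 2) (goodstein n i) - 1"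
  by (simp add: rebase_def[symmetric]) (simp add: rebase_def numeral_3_eq_3)

text \<open>Least significant digit first. Unlike in normal forms, zeros are allowed, so that the
  position in the list is the exponent.\<close>

primrec eval_digits :: "nat \<Rightarrow> nat list \<Rightarrow> nat" where
  "eval_digits b [] = 0"
| "eval_digits b (d # ds) = d + b * eval_digits b ds"

lemma eval_digits_append:
  "eval_digits b (xs @ ys) = eval_digits b xs + b ^ length xs * eval_digits b ys"
  by (induction xs) (auto simp: algebra_simps)

lemma eval_digits_replicate_0 [simp]: "eval_digits b (replicate k 0) = 0"
  by (induction k) auto

text \<open>Used for borrowing: subtracting 1 turns \<open>k\<close> trailing zeros into maximal
  digits.\<close>

lemma eval_digits_replicate_max: "Suc (eval_digits (Suc b) (replicate k b)) = Suc b ^ k"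
proof (induction k)
  case (Suc k)
  have "Suc (eval_digits (Suc b) (replicate (Suc k) b)) =
      Suc b * Suc (eval_digits (Suc b) (replicate k b))"
    by simp
  then show ?case by (simp only: Suc power_Suc)
qed simp

lemma rebase_eval_digits:
  assumes "b \<ge> 2" "\<forall>d \<in> set ds. d < b"
  shows "rebase b (eval_digits b ds) = eval_digits (Suc b) ds"
  using assms(2)
proof (induction ds)
  case Nil
  then show ?case using assms(1) by simp
next
  case (Cons d ds)
  then show ?case using assms(1) rebase_rec[OF assms(1), of "eval_digits b (d # ds)"] by simp
qed

text \<open>The recursion mirrors the loss of one unit of a digit: a step in base \<open>x\<close>
  moves to base \<open>Suc x\<close>, and the borrow leaves the digit \<open>x\<close> one position
  lower, whose units account for \<open>x\<close> iterations.\<close>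

primrec ack :: "nat \<Rightarrow> nat \<Rightarrow> nat" where
  "ack 0 x = Suc x"
| "ack (Suc k) x = (ack k ^^ x) (Suc x)"

lemma funpow_ge:
  fixes f :: "nat \<Rightarrow> nat"
  assumes "\<And>x. x \<le> f x"
  shows "x \<le> (f ^^ n) x"
  by (induction n) (auto intro: order_trans assms)

lemma ack_gt: "x < ack k x"
proof (induction k arbitrary: x)
  case (Suc k)
  have "Suc x \<le> (ack k ^^ x) (Suc x)"
    by (rule funpow_ge) (simp add: Suc less_imp_le)
  then show ?case by simp
qed simp

lemma funpow_ack_ge: "x \<le> (ack k ^^ n) x"
  by (rule funpow_ge) (simp add: ack_gt less_imp_le)

lemma funpow_mono_nat:
  fixes f :: "nat \<Rightarrow> nat"
  assumes "mono f" "\<And>x. x \<le> f x" "m \<le> n" "x \<le> y"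
  shows "(f ^^ m) x \<le> (f ^^ n) y"
proof -
  have "(f ^^ m) x \<le> (f ^^ m) y" using assms(1,4) by (rule funpow_mono)
  also have "\<dots> \<le> (f ^^ (n - m)) ((f ^^ m) y)" using assms(2) by (rule funpow_ge)
  also have "\<dots> = (f ^^ (n - m + m)) y" by (simp add: funpow_add)
  finally show ?thesis using assms(3) by simp
qed

lemma mono_ack: "mono (ack k)"
proof (induction k)
  case (Suc k)
  show ?case
  proof (rule monoI)
    fix x y :: nat
    assume "x \<le> y"
    then show "ack (Suc k) x \<le> ack (Suc k) y"
      using funpow_mono_nat[OF Suc less_imp_le[OF ack_gt], of x y "Suc x" "Suc y"] by simp
  qed
qed (simp add: mono_def)

lemma ack_mono: "x \<le> y \<Longrightarrow> ack k x \<le> ack k y"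
  using mono_ack by (rule monoD)

lemmas funpow_ack_mono = funpow_mono_nat[OF mono_ack less_imp_le[OF ack_gt]]

lemma ack_Suc_ge_funpow:
  assumes "n \<le> x" "y \<le> Suc x"
  shows "(ack k ^^ n) y \<le> ack (Suc k) x"
  using funpow_ack_mono[OF assms] by simp

lemma ack_le_Suc: "ack k x \<le> ack (Suc k) x"
proof (cases x)
  case 0
  \<comment> \<open>At 0 the next level makes no iteration, so this value is computed
    directly.\<close>
  have "ack k 0 = 1" by (induction k) auto
  then show ?thesis using 0 by simp
next
  case (Suc x')
  then show ?thesis using ack_Suc_ge_funpow[of 1 x x k] by simp
qed

lemma ack_mono_level: "k \<le> l \<Longrightarrow> ack k x \<le> ack l x"
  by (rule lift_Suc_mono_le[of "\<lambda>k. ack k x"]) (rule ack_le_Suc)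

lemma ack_ack_le: "2 \<le> x \<Longrightarrow> ack k (ack k x) \<le> ack (Suc k) x"
  using ack_Suc_ge_funpow[of 2 x x k] by (simp add: numeral_2_eq_2)

text \<open>One unit of the digit in position \<open>k\<close> is used up only after the base has grown
  from \<open>b\<close> to at least \<open>ack k b\<close>: borrowing from it leaves the digit \<open>b\<close> in position \<open>k - 1\<close>.\<close>

lemma goodstein_digit_step:
  assumes "goodstein n i \<ge> eval_digits (i + 2) (replicate k 0 @ Suc c # ds)"
    and "Suc c < i + 2" "\<forall>d \<in> set ds. d < i + 2"
  shows "\<exists>j\<ge>i. j + 2 \<ge> ack k (i + 2) \<and>
    goodstein n j \<ge> eval_digits (j + 2) (replicate k 0 @ c # ds)"
  using assms
proof (induction k arbitrary: i c ds)
  case 0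
  have "rebase (i + 2) (eval_digits (i + 2) (Suc c # ds)) = eval_digits (Suc (i + 2)) (Suc c # ds)"
    using 0 by (intro rebase_eval_digits) auto
  moreover have "rebase (i + 2) (eval_digits (i + 2) (Suc c # ds)) \<le> rebase (i + 2) (goodstein n i)"
    using 0 by (intro rebase_mono) auto
  ultimately have "goodstein n (Suc i) \<ge> eval_digits (Suc i + 2) (c # ds)"
    unfolding goodstein_Suc_rebase by simp
  then show ?case by (intro exI[of _ "Suc i"]) auto
next
  case (Suc k)
  note IH = Suc.IH
  have "rebase (i + 2) (eval_digits (i + 2) (replicate (Suc k) 0 @ Suc c # ds)) =
      eval_digits (Suc (i + 2)) (replicate (Suc k) 0 @ Suc c # ds)"
    using Suc.prems by (intro rebase_eval_digits) auto
  moreover have "rebase (i + 2) (eval_digits (i + 2) (replicate (Suc k) 0 @ Suc c # ds)) \<le>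
      rebase (i + 2) (goodstein n i)"
    using Suc.prems by (intro rebase_mono) auto
  ultimately have "goodstein n (Suc i) \<ge>
      eval_digits (Suc (i + 2)) (replicate (Suc k) 0 @ Suc c # ds) - 1"
    unfolding goodstein_Suc_rebase by simp
  \<comment> \<open>The borrow: the trailing zeros become digits \<open>i + 2\<close>, maximal in
    base \<open>i + 3\<close>, and \<open>Suc c\<close> drops to \<open>c\<close>.\<close>
  moreover have "eval_digits (Suc (i + 2)) (replicate (Suc k) 0 @ Suc c # ds) - 1 =
      eval_digits (Suc (i + 2)) (replicate (Suc k) (i + 2) @ c # ds)"
    using eval_digits_replicate_max[of "i + 2" "Suc k", symmetric]
    by (simp only: eval_digits_append eval_digits_replicate_0 length_replicate
      eval_digits.simps add_Suc mult_Suc_right)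
  \<comment> \<open>The digits below position \<open>k\<close> are given up, which restores the
    shape that the induction hypothesis needs.\<close>
  moreover have "\<dots> \<ge> eval_digits (Suc (i + 2)) (replicate k 0 @ (i + 2) # c # ds)"
    by (simp add: eval_digits_append flip: replicate_append_same)
  ultimately have start:
    "goodstein n (Suc i) \<ge> eval_digits (Suc i + 2) (replicate k 0 @ (i + 2) # c # ds)"
    by simp
  \<comment> \<open>Each use of the induction hypothesis takes one unit off the digit in position
    \<open>k\<close> and raises the base by at least one application of \<open>ack k\<close>;
    \<open>m\<close> counts these uses.\<close>
  have "\<exists>j\<ge>Suc i. j + 2 \<ge> (ack k ^^ m) (i + 3) \<and>
      goodstein n j \<ge> eval_digits (j + 2) (replicate k 0 @ (i + 2 - m) # c # ds)"
    if "m \<le> i + 2" for m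
    using that
  proof (induction m)
    case 0
    then show ?case using start by auto
  next
    case (Suc m)
    then obtain j where j: "j \<ge> Suc i" "j + 2 \<ge> (ack k ^^ m) (i + 3)"
      "goodstein n j \<ge> eval_digits (j + 2) (replicate k 0 @ (i + 2 - m) # c # ds)"
      by auto
    have "i + 2 - m = Suc (i + 2 - Suc m)" using Suc.prems by simp
    then have "goodstein n j \<ge> eval_digits (j + 2) (replicate k 0 @ Suc (i + 2 - Suc m) # c # ds)"
      using j(3) by simp
    moreover have "Suc (i + 2 - Suc m) < j + 2" "\<forall>d \<in> set (c # ds). d < j + 2"
      using j(1) Suc.prems \<open>Suc c < i + 2\<close> \<open>\<forall>d\<in>set ds. d < i + 2\<close> by fastforce+
    ultimately obtain j' where j': "j' \<ge> j" "j' + 2 \<ge> ack k (j + 2)"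
      "goodstein n j' \<ge> eval_digits (j' + 2) (replicate k 0 @ (i + 2 - Suc m) # c # ds)"
      using IH by blast
    have "(ack k ^^ Suc m) (i + 3) \<le> j' + 2"
      using ack_mono[OF j(2), of k] j'(2) by simp
    then show ?case using j j' by (intro exI[of _ j']) auto
  qed
  from this[of "i + 2"] obtain j where j: "j \<ge> Suc i" "j + 2 \<ge> (ack k ^^ (i + 2)) (i + 3)"
    "goodstein n j \<ge> eval_digits (j + 2) (replicate k 0 @ 0 # c # ds)"
    by auto
  have "j + 2 \<ge> ack (Suc k) (i + 2)" using j(2) by (simp add: numeral_3_eq_3)
  have "replicate k 0 @ 0 # c # ds = replicate (Suc k) 0 @ c # ds"
    by (simp add: replicate_app_Cons_same)
  then have "goodstein n j \<ge> eval_digits (j + 2) (replicate (Suc k) 0 @ c # ds)"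
    using j(3) by metis
  moreover have "i \<le> j" using j(1) by simp
  ultimately show ?case using \<open>j + 2 \<ge> ack (Suc k) (i + 2)\<close> by blast
qed

lemma goodstein_zero_absorbing: "goodstein n i = 0 \<Longrightarrow> i \<le> j \<Longrightarrow> goodstein n j = 0"
  by (induction j) (auto simp: le_Suc_eq)

text \<open>In base 2 the start value has the digit 1 in positions \<open>k\<close> and
  \<open>k + 1\<close>. When the lower one is used up, the base has reached \<open>ack k 2\<close>,
  and the upper one still keeps the value positive.\<close>

lemma goodstein_zero_bound:
  assumes "goodstein (3 * 2 ^ k) i = 0"
  shows "ack k 2 \<le> i + 2"
proof -
  have "goodstein (3 * 2 ^ k) 0 \<ge> eval_digits (0 + 2) (replicate k 0 @ Suc 0 # [1])"
    by (simp add: eval_digits_append numeral_2_eq_2 numeral_3_eq_3)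
  then obtain j where j: "j + 2 \<ge> ack k (0 + 2)"
    "goodstein (3 * 2 ^ k) j \<ge> eval_digits (j + 2) (replicate k 0 @ 0 # [1])"
    using goodstein_digit_step by (metis Suc_1 add_0 lessI list.set(1) list.set(2) One_nat_def singletonD)
  have "0 < eval_digits (j + 2) (replicate k 0 @ 0 # [1])"
    by (simp add: eval_digits_append)
  then have "goodstein (3 * 2 ^ k) j \<noteq> 0" using j by linarith
  then have "j < i" using assms goodstein_zero_absorbing by (meson not_le)
  then show ?thesis using j by (simp add: numeral_2_eq_2)
qed

section \<open>Growth estimates for the hierarchy\<close>

lemma ack_1: "ack 1 x = 2 * x + 1"
proof -
  have "(Suc ^^ n) y = n + y" for n y by (induction n) auto
  moreover have "ack 0 = Suc" by (rule ext) simp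
  ultimately show ?thesis by simp
qed

lemma ack_2_ge_square: "x * x \<le> ack 2 x"
proof -
  have "2 ^ n * y \<le> (ack 1 ^^ n) y" for n y
  proof (induction n)
    case (Suc n)
    have "2 * (2 ^ n * y) \<le> 2 * (ack 1 ^^ n) y + 1" using Suc by linarith
    moreover have "(ack 1 ^^ Suc n) y = 2 * (ack 1 ^^ n) y + 1"
      unfolding funpow.simps o_apply by (rule ack_1)
    ultimately show ?case by (simp only: power_Suc mult.assoc)
  qed simp
  from this[of x "Suc x"] have "2 ^ x * Suc x \<le> ack 2 x"
    by (simp add: numeral_2_eq_2)
  moreover have "x * x \<le> 2 ^ x * Suc x"
    by (intro mult_le_mono) (simp_all add: less_imp_le)
  ultimately show ?thesis by linarith
qed

lemma ack_lt_Suc: "2 \<le> x \<Longrightarrow> ack k x < ack (Suc k) x"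
  using ack_gt[of "ack k x" k] ack_ack_le[of x k] by simp

text \<open>Places the Goodstein start value below the chains built later, which begin at or above
  \<open>ack k 3\<close>. Doubling is dominated from level 1 on, so the step from level 0 is checked
  separately.\<close>

lemma ack_3_ge: "3 * 2 ^ k \<le> ack k 3"
proof (induction k)
  case (Suc k)
  show ?case
  proof (cases k)
    case 0
    then show ?thesis using ack_1[of 3] by simp
  next
    case (Suc k')
    have "2 * ack k 3 \<le> ack 1 (ack k 3)" by (simp add: ack_1 del: One_nat_def)
    also have "\<dots> \<le> ack k (ack k 3)" using Suc by (intro ack_mono_level) simp
    also have "\<dots> \<le> ack (Suc k) 3" by (rule ack_ack_le) simp
    finally show ?thesis using \<open>3 * 2 ^ k \<le> ack k 3\<close> by simp
  qed
qed simp

text \<open>Arguments start at 2 because absorbing a double application into the next level, as in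
  \<open>ack_ack_le\<close>, takes two iterations.\<close>

definition ack_bounded :: "(nat \<Rightarrow> nat) \<Rightarrow> bool" where
  "ack_bounded f \<longleftrightarrow> (\<exists>K. \<forall>a\<ge>2. f a \<le> ack K a)"

lemma ack_bounded_const: "ack_bounded (\<lambda>_. c)"
proof -
  have "c \<le> ack c a" if "2 \<le> a" for a
  proof (induction c)
    case (Suc c)
    then show ?case using ack_lt_Suc[OF that, of c] by linarith
  qed simp
  then show ?thesis unfolding ack_bounded_def by blast
qed

lemma ack_bounded_Suc: "ack_bounded Suc"
  unfolding ack_bounded_def by (intro exI[of _ 0]) simp

lemma ack_bounded_times:
  assumes "ack_bounded f" "ack_bounded g"
  shows "ack_bounded (\<lambda>a. f a * g a)"
proof -
  obtain K L where K: "\<And>a. 2 \<le> a \<Longrightarrow> f a \<le> ack K a" and L: "\<And>a. 2 \<le> a \<Longrightarrow> g a \<le> ack L a"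
    using assms unfolding ack_bounded_def by blast
  \<comment> \<open>The summand 2 puts \<open>M\<close> at a level that dominates squaring.\<close>
  define M where "M = K + L + 2"
  have "f a * g a \<le> ack (Suc M) a" if "2 \<le> a" for a
  proof -
    have "f a \<le> ack M a" "g a \<le> ack M a"
      using K[OF that] L[OF that] ack_mono_level[of K M a] ack_mono_level[of L M a]
      by (simp_all add: M_def)
    then have "f a * g a \<le> ack M a * ack M a" by (rule mult_le_mono)
    also have "\<dots> \<le> ack 2 (ack M a)" by (rule ack_2_ge_square)
    also have "\<dots> \<le> ack M (ack M a)" by (rule ack_mono_level) (simp add: M_def)
    also have "\<dots> \<le> ack (Suc M) a" using that by (rule ack_ack_le)
    finally show ?thesis .
  qed
  then show ?thesis unfolding ack_bounded_def by blast
qed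

lemma ack_bounded_power: "ack_bounded f \<Longrightarrow> ack_bounded (\<lambda>a. f a ^ n)"
  by (induction n) (simp_all add: ack_bounded_const ack_bounded_times)

section \<open>Chains with gaps\<close>

text \<open>Codes of formulas let the \<open>m\<close>-th approximation deal with the finitely many
  formulas whose code is below \<open>m\<close>.\<close>

instance trm :: countable by countable_datatype
instance atm :: countable by countable_datatype
instance fm :: countable by countable_datatype

section \<open>Substitution and coincidence in the standard model\<close>

lemma val_subst_trm: "val e (subst_trm \<sigma> t) = val (\<lambda>i. val e (\<sigma> i)) t"
  by (induction t) auto

lemma sat_atm_subst_atm: "sat_atm e (subst_atm \<sigma> a) \<longleftrightarrow> sat_atm (\<lambda>i. val e (\<sigma> i)) a"
  by (cases a) (auto simp: val_subst_trm)

lemma val_cong: "(\<And>i. i < level_trm t \<Longrightarrow> e i = e' i) \<Longrightarrow> val e t = val e' t"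
  by (induction t) auto

lemma sat_cong: "(\<And>i. i < level \<phi> \<Longrightarrow> e i = e' i) \<Longrightarrow> sat e \<phi> \<longleftrightarrow> sat e' \<phi>"
proof (induction \<phi> arbitrary: e e')
  case (Atom a)
  then show ?case by (cases a) (auto simp: less_max_iff_disj intro!: arg_cong2[where f = "(=)"] arg_cong2[where f = "(\<le>)"] val_cong)
next
  case (NegAtom a)
  then show ?case by (cases a) (auto simp: less_max_iff_disj intro!: arg_cong2[where f = "(=)"] arg_cong2[where f = "(\<le>)"] val_cong)
next
  case (And \<phi> \<psi>)
  then show ?case by (metis level.simps(3) max.strict_coboundedI1 max.strict_coboundedI2 sat.simps(3))
next
  case (Or \<phi> \<psi>)
  then show ?case by (metis level.simps(4) max.strict_coboundedI1 max.strict_coboundedI2 sat.simps(4))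
next
  case (Forall \<phi>)
  have "sat (a ;; e) \<phi> \<longleftrightarrow> sat (a ;; e') \<phi>" for a
    using Forall.prems by (intro Forall.IH) (auto split: nat.split)
  then show ?case by simp
next
  case (Exists \<phi>)
  have "sat (a ;; e) \<phi> \<longleftrightarrow> sat (a ;; e') \<phi>" for a
    using Exists.prems by (intro Exists.IH) (auto split: nat.split)
  then show ?case by simp
qed

text \<open>Pigeonhole: if each of the \<open>N + 1\<close> intervals from \<open>c j\<close> to
  \<open>c (Suc j)\<close> contained the least witness of some \<open>q\<close>, different intervals
  would need different \<open>q\<close>, as a witness once found stays below all later
  bounds.\<close>

lemma ex_gap:
  fixes c :: "nat \<Rightarrow> nat"
  assumes "finite J" "card J \<le> N" "mono c"
  shows "\<exists>j\<le>N. \<forall>q\<in>J. (\<exists>y\<le>c (Suc j). P q y) \<longrightarrow> (\<exists>y\<le>c j. P q y)"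
proof (rule ccontr)
  assume "\<not> ?thesis"
  then have "\<forall>j\<in>{..N}. \<exists>q\<in>J. (\<exists>y\<le>c (Suc j). P q y) \<and> \<not> (\<exists>y\<le>c j. P q y)"
    by blast
  then obtain q where q: "\<And>j. j \<le> N \<Longrightarrow> q j \<in> J"
    "\<And>j. j \<le> N \<Longrightarrow> \<exists>y\<le>c (Suc j). P (q j) y"
    "\<And>j. j \<le> N \<Longrightarrow> \<not> (\<exists>y\<le>c j. P (q j) y)"
    by (metis atMost_iff)
  have neq: "q i \<noteq> q j" if "i < j" "j \<le> N" for i j
  proof
    assume eq: "q i = q j"
    have "c (Suc i) \<le> c j" using assms(3) that by (simp add: monoD)
    then show False using q(2)[of i] q(3)[of j] that eq by (metis le_trans less_imp_le)
  qed
  have "inj_on q {..N}"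
    by (rule linorder_inj_onI) (use neq in auto)
  then have "card {..N} \<le> card J"
    by (rule card_inj_on_le) (use q(1) assms(1) in auto)
  then show False using assms(2) by simp
qed

text \<open>The chain is built from its first element: \<open>ex_gap\<close> supplies a gap for the
  queries in \<open>J a\<close>, and the rest of the chain is placed inside that gap. Each element
  costs two levels, one to pass from \<open>a\<close> to some \<open>a'\<close> above
  \<open>B a\<close>, and one to iterate level \<open>k\<close> more than \<open>B a\<close>
  times.\<close>

lemma ex_gap_chain:
  fixes J :: "nat \<Rightarrow> 'q set" and P :: "'q \<Rightarrow> nat \<Rightarrow> bool"
  assumes "\<And>a. finite (J a)" "\<And>a. card (J a) \<le> B a" "\<And>a. 2 \<le> a \<Longrightarrow> B a \<le> ack K a"
    and "2 \<le> a" "ack (K + 2 * m) a \<le> b"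
  shows "\<exists>s. mono s \<and> a \<le> s 0 \<and> s m \<le> b \<and> (\<forall>i<m. B (s i) \<le> s (Suc i)) \<and>
    (\<forall>i<m. \<forall>q\<in>J (s i). (\<exists>y\<le>s m. P q y) \<longrightarrow> (\<exists>y\<le>s (Suc i). P q y))"
  using assms(4,5)
proof (induction m arbitrary: a b)
  case 0
  then show ?case using ack_gt[of a K] by (intro exI[of _ "\<lambda>_. a"]) (auto simp: mono_def)
next
  case (Suc m)
  define k where "k = K + 2 * m"
  define a' where "a' = ack (Suc k) a"
  define c where "c j = (ack k ^^ j) a'" for j
  have "ack (Suc k) a' \<le> b"
    using ack_ack_le[OF Suc.prems(1), of "Suc k"] Suc.prems(2) by (simp add: a'_def k_def)
  have "a < a'" unfolding a'_def by (rule ack_gt)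
  have "B a < a'"
  proof -
    have "B a \<le> ack K a" using Suc.prems(1) by (rule assms(3))
    also have "\<dots> \<le> ack k a" by (rule ack_mono_level) (simp add: k_def)
    also have "\<dots> < a'" unfolding a'_def using Suc.prems(1) by (rule ack_lt_Suc)
    finally show ?thesis .
  qed
  have "mono c" unfolding c_def by (intro monoI funpow_ack_mono order_refl)
  from ex_gap[OF assms(1) assms(2) this, where P = P]
  obtain j where j: "j \<le> B a" "\<forall>q\<in>J a. (\<exists>y\<le>c (Suc j). P q y) \<longrightarrow> (\<exists>y\<le>c j. P q y)"
    by blast
  have "a' \<le> c j" unfolding c_def by (rule funpow_ack_ge)
  have "c (Suc j) \<le> c (Suc (B a))" using \<open>mono c\<close> j(1) by (simp add: monoD)
  also have "\<dots> \<le> ack (Suc k) a'"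
    unfolding c_def using \<open>B a < a'\<close> by (intro ack_Suc_ge_funpow) auto
  also have "\<dots> \<le> b" by fact
  finally have cb: "c (Suc j) \<le> b" .
  \<comment> \<open>The gap reaches from \<open>c j\<close> to \<open>ack k (c j)\<close>, just the
    room that a chain of \<open>m\<close> steps requires.\<close>
  have "2 \<le> c j" using Suc.prems(1) \<open>a < a'\<close> \<open>a' \<le> c j\<close> by simp
  moreover have "ack (K + 2 * m) (c j) \<le> c (Suc j)" by (simp add: c_def k_def)
  ultimately obtain s where s: "mono s" "c j \<le> s 0" "s m \<le> c (Suc j)"
    "\<forall>i<m. B (s i) \<le> s (Suc i)"
    "\<forall>i<m. \<forall>q\<in>J (s i). (\<exists>y\<le>s m. P q y) \<longrightarrow> (\<exists>y\<le>s (Suc i). P q y)"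
    using Suc.IH[of "c j" "c (Suc j)"] by blast
  have "a \<le> s 0" using \<open>a < a'\<close> \<open>a' \<le> c j\<close> s(2) by simp
  then have "(a ;; s) n \<le> (a ;; s) (Suc n)" for n
    using s(1) by (cases n) (simp_all add: monoD)
  then have "mono (a ;; s)" by (simp add: mono_iff_le_Suc)
  moreover have "B ((a ;; s) i) \<le> (a ;; s) (Suc i)" if "i < Suc m" for i
    using that s(2,4) \<open>B a < a'\<close> \<open>a' \<le> c j\<close> by (cases i) auto
  moreover have "\<exists>y\<le>(a ;; s) (Suc i). P q y"
    if "i < Suc m" "q \<in> J ((a ;; s) i)" "\<exists>y\<le>(a ;; s) (Suc m). P q y" for i q
  proof (cases i)
    case 0
    \<comment> \<open>The whole remaining chain lies inside the gap, so a witness below its end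
      yields one below \<open>c j\<close>.\<close>
    then have "\<exists>y\<le>c j. P q y"
      using that j(2) s(3) by (metis le_trans nat.case(1) nat.case(2))
    then show ?thesis using 0 s(2) by (metis le_trans nat.case(2))
  next
    case (Suc i')
    then show ?thesis using that s(5) by simp
  qed
  ultimately show ?case
    using s(3) cb by (intro exI[of _ "a ;; s"]) auto
qed

text \<open>Values from \<open>d\<close> on are fixed to 0 to make the set finite; formulas of level
  at most \<open>d\<close> do not depend on them.\<close>

definition bounded_envs :: "nat \<Rightarrow> nat \<Rightarrow> (nat \<Rightarrow> nat) set" where
  "bounded_envs d a = {e. (\<forall>i. e i \<le> a) \<and> (\<forall>i\<ge>d. e i = 0)}"

lemma bounded_envs: "finite (bounded_envs d a)" "card (bounded_envs d a) \<le> Suc a ^ d"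
proof -
  let ?L = "{xs. set xs \<subseteq> {..a} \<and> length xs = d}"
  let ?f = "\<lambda>xs i. if i < d then xs ! i else (0::nat)"
  have sub: "bounded_envs d a \<subseteq> ?f ` ?L"
  proof
    fix e
    assume e: "e \<in> bounded_envs d a"
    then have "e = ?f (map e [0..<d])" by (auto simp: bounded_envs_def fun_eq_iff)
    moreover have "map e [0..<d] \<in> ?L" using e by (auto simp: bounded_envs_def)
    ultimately show "e \<in> ?f ` ?L" by (rule image_eqI)
  qed
  have fin: "finite ?L" by (rule finite_lists_length_eq) simp
  show "finite (bounded_envs d a)" by (rule finite_subset[OF sub finite_imageI[OF fin]])
  have "card (bounded_envs d a) \<le> card (?f ` ?L)" using sub fin by (intro card_mono) auto
  also have "\<dots> \<le> card ?L" using fin by (rule card_image_le)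
  also have "\<dots> = Suc a ^ d" by (simp add: card_lists_length_eq)
  finally show "card (bounded_envs d a) \<le> Suc a ^ d" .
qed

text \<open>Supplies coordinate \<open>m\<close> of the ultrapower. A query is a formula code below
  \<open>m\<close> together with an assignment bounded by \<open>s i\<close>. The chain fits between
  \<open>ack k 3\<close> and \<open>ack k (ack k 3)\<close>, and the latter is
  \<open>ack (Suc k) 2\<close>.\<close>

lemma ex_approximation:
  "\<exists>k s. mono s \<and> 3 * 2 ^ k \<le> s 0 \<and> s m \<le> ack (Suc k) 2 \<and>
     (\<forall>i<m. Suc (s i) * Suc (s i) \<le> s (Suc i)) \<and>
     (\<forall>i<m. \<forall>\<theta> e. to_nat \<theta> < m \<longrightarrow> (\<forall>l. e l \<le> s i) \<longrightarrow> (\<forall>l\<ge>level \<theta>. e l = 0) \<longrightarrow>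
        (\<exists>y\<le>s m. sat (y ;; e) \<theta>) \<longrightarrow> (\<exists>y\<le>s (Suc i). sat (y ;; e) \<theta>))"
proof -
  define d where "d = (\<Sum>j<m. level (from_nat j))"
  have level_le: "level \<theta> \<le> d" if "to_nat \<theta> < m" for \<theta>
  proof -
    have "level (from_nat (to_nat \<theta>)) \<le> d"
      unfolding d_def using that by (intro member_le_sum) auto
    then show ?thesis by simp
  qed
  \<comment> \<open>\<open>B\<close> serves two ends: it bounds the number of queries, and it
    dominates \<open>Suc a * Suc a\<close>, which will close the cut under arithmetic.\<close>
  define B where "B a = Suc m * Suc a ^ (d + 2)" for a
  have "ack_bounded B"
    unfolding B_def
    by (rule ack_bounded_times[OF ack_bounded_const ack_bounded_power[OF ack_bounded_Suc]])
  then obtain K where K: "\<And>a. 2 \<le> a \<Longrightarrow> B a \<le> ack K a"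
    unfolding ack_bounded_def by blast
  define k where "k = K + 2 * m"
  define J where "J a = {..<m} \<times> bounded_envs d a" for a
  have fin: "finite (J a)" for a by (simp add: J_def bounded_envs)
  have card: "card (J a) \<le> B a" for a
  proof -
    have "card (J a) = m * card (bounded_envs d a)" by (simp add: J_def card_cartesian_product)
    also have "\<dots> \<le> Suc m * Suc a ^ (d + 2)"
      by (intro mult_le_mono order_trans[OF bounded_envs(2)] power_increasing) auto
    finally show ?thesis by (simp add: B_def)
  qed
  have B_ge: "Suc a * Suc a \<le> B a" for a
  proof -
    have "1 * Suc a ^ 2 \<le> Suc m * Suc a ^ (d + 2)"
      by (intro mult_le_mono power_increasing) auto
    then show ?thesis by (simp only: B_def power2_eq_square mult_1)
  qed
  have "2 \<le> ack k 3" using ack_gt[of 3 k] by simp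
  moreover have "ack k (ack k 3) \<le> ack (Suc k) 2"
    using ack_Suc_ge_funpow[of 2 2 3 k] by (simp add: numeral_2_eq_2)
  ultimately obtain s where s: "mono s" "ack k 3 \<le> s 0" "s m \<le> ack (Suc k) 2"
    "\<And>i. i < m \<Longrightarrow> B (s i) \<le> s (Suc i)"
    "\<And>i q. i < m \<Longrightarrow> q \<in> J (s i) \<Longrightarrow> \<exists>y\<le>s m. sat (y ;; snd q) (from_nat (fst q)) \<Longrightarrow>
      \<exists>y\<le>s (Suc i). sat (y ;; snd q) (from_nat (fst q))"
    using ex_gap_chain[OF fin card K, of "ack k 3" m "ack (Suc k) 2"
        "\<lambda>q y. sat (y ;; snd q) (from_nat (fst q))"]
    unfolding k_def by blast
  have "\<exists>y\<le>s (Suc i). sat (y ;; e) \<theta>"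
    if "i < m" "to_nat \<theta> < m" "\<forall>l. e l \<le> s i" "\<forall>l\<ge>level \<theta>. e l = 0" "\<exists>y\<le>s m. sat (y ;; e) \<theta>"
    for i e \<theta>
  proof -
    have "(to_nat \<theta>, e) \<in> J (s i)"
      using that level_le[OF that(2)] by (auto simp: J_def bounded_envs_def)
    then show ?thesis using s(5)[OF that(1)] that(5) by fastforce
  qed
  moreover have "Suc (s i) * Suc (s i) \<le> s (Suc i)" if "i < m" for i
    using B_ge[of "s i"] s(4)[OF that] by linarith
  moreover have "3 * 2 ^ k \<le> s 0" using ack_3_ge[of k] s(2) by linarith
  ultimately show ?thesis using s(1,3) by blast
qed

section \<open>Semiregular cuts of an ultrapower\<close>

text \<open>Zorn's lemma for proper filters, given as families of sets, that contain all tails; a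
  maximal one decides every set. Being below \<open>sequentially\<close> expresses freeness.\<close>

lemma ex_free_ultrafilter:
  "\<exists>U :: nat filter. U \<noteq> bot \<and> U \<le> sequentially \<and>
     (\<forall>P. eventually P U \<or> eventually (\<lambda>m. \<not> P m) U)"
proof -
  define filt :: "nat set set \<Rightarrow> bool" where
    "filt F \<longleftrightarrow> (\<forall>n. {n..} \<in> F) \<and> {} \<notin> F \<and> (\<forall>A\<in>F. \<forall>B\<in>F. A \<inter> B \<in> F) \<and>
       (\<forall>A\<in>F. \<forall>B. A \<subseteq> B \<longrightarrow> B \<in> F)" for F
  have "\<exists>F\<in>Collect filt. \<forall>G\<in>Collect filt. F \<subseteq> G \<longrightarrow> G = F"
  proof (rule subset_Zorn_nonempty)
    have "filt {A. \<exists>n::nat. {n..} \<subseteq> A}"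
      unfolding filt_def
    proof (intro conjI ballI allI impI)
      show "{n..} \<in> {A. \<exists>n::nat. {n..} \<subseteq> A}" for n by blast
      show "{} \<notin> {A. \<exists>n::nat. {n..} \<subseteq> A}" by simp
      fix A B
      assume "A \<in> {A. \<exists>n::nat. {n..} \<subseteq> A}" "B \<in> {A. \<exists>n::nat. {n..} \<subseteq> A}"
      then obtain m n :: nat where "{m..} \<subseteq> A" "{n..} \<subseteq> B" by blast
      then have "{max m n..} \<subseteq> A \<inter> B" by auto
      then show "A \<inter> B \<in> {A. \<exists>n::nat. {n..} \<subseteq> A}" by blast
    qed blast
    then show "Collect filt \<noteq> {}" by blast
  next
    fix \<C>
    assume "\<C> \<noteq> {}" and chain: "subset.chain (Collect filt) \<C>"
    then have filt: "filt F" if "F \<in> \<C>" for F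
      using that by (auto simp: subset_chain_def)
    show "\<Union>\<C> \<in> Collect filt"
      unfolding filt_def mem_Collect_eq
    proof (intro conjI ballI allI impI)
      show "{n..} \<in> \<Union>\<C>" for n
        using \<open>\<C> \<noteq> {}\<close> filt unfolding filt_def by (metis UnionI all_not_in_conv)
      show "{} \<notin> \<Union>\<C>"
        using filt unfolding filt_def by blast
      show "B \<in> \<Union>\<C>" if "A \<in> \<Union>\<C>" "A \<subseteq> B" for A B
        using that filt unfolding filt_def by blast
      fix A B
      assume "A \<in> \<Union>\<C>" "B \<in> \<Union>\<C>"
      then obtain F G where FG: "F \<in> \<C>" "G \<in> \<C>" "A \<in> F" "B \<in> G" by blast
      then have "F \<subseteq> G \<or> G \<subseteq> F"
        using chain by (auto simp: subset_chain_def)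
      then show "A \<inter> B \<in> \<Union>\<C>"
        using FG filt unfolding filt_def by blast
    qed
  qed
  then obtain F where F: "filt F" and max: "\<And>G. filt G \<Longrightarrow> F \<subseteq> G \<Longrightarrow> G = F" by auto
  have tails: "{n..} \<in> F" for n using F by (simp add: filt_def)
  have nonempty: "{} \<notin> F" using F by (simp add: filt_def)
  have inter: "A \<inter> B \<in> F" if "A \<in> F" "B \<in> F" for A B
    using F that by (simp add: filt_def)
  have up: "B \<in> F" if "A \<in> F" "A \<subseteq> B" for A B
    using F that unfolding filt_def by blast
  have ultra: "P \<in> F \<or> - P \<in> F" for P
  proof (rule ccontr)
    assume neither: "\<not> (P \<in> F \<or> - P \<in> F)"
    \<comment> \<open>The filter generated by \<open>F\<close> and \<open>P\<close>; it is proper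
      because \<open>- P\<close> is not in \<open>F\<close>.\<close>
    define G where "G = {B. \<exists>A\<in>F. A \<inter> P \<subseteq> B}"
    have "filt G"
      unfolding filt_def
    proof (intro conjI ballI allI impI)
      show "{n..} \<in> G" for n using tails[of n] by (auto simp: G_def)
      show "{} \<notin> G" using neither up by (auto simp: G_def disjoint_eq_subset_Compl)
      show "B \<in> G" if "A \<in> G" "A \<subseteq> B" for A B
        using that by (auto simp: G_def)
      fix A B
      assume "A \<in> G" "B \<in> G"
      then obtain A' B' where AB: "A' \<in> F" "B' \<in> F" "A' \<inter> P \<subseteq> A" "B' \<inter> P \<subseteq> B"
        by (auto simp: G_def)
      then have "A' \<inter> B' \<inter> P \<subseteq> A \<inter> B" by blast
      then show "A \<inter> B \<in> G"
        unfolding G_def using inter[OF AB(1,2)] by blast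
    qed
    moreover have "F \<subseteq> G" by (auto simp: G_def)
    ultimately have "G = F" by (rule max)
    moreover have "P \<in> G" using tails[of 0] by (auto simp: G_def)
    ultimately show False using neither by simp
  qed
  define U where "U = Abs_filter (\<lambda>P. Collect P \<in> F)"
  have ev: "eventually P U \<longleftrightarrow> Collect P \<in> F" for P
    unfolding U_def
  proof (rule eventually_Abs_filter, rule is_filter.intro)
    show "Collect (\<lambda>x. True) \<in> F" using up[OF tails[of 0]] by simp
    show "Collect (\<lambda>x. P x \<and> Q x) \<in> F" if "Collect P \<in> F" "Collect Q \<in> F" for P Q
      using inter[OF that] by (simp add: Collect_conj_eq)
    show "Collect Q \<in> F" if "\<forall>x. P x \<longrightarrow> Q x" "Collect P \<in> F" for P Q
      using up[OF that(2)] that(1) by blast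
  qed
  have "U \<noteq> bot"
    using nonempty ev[of "\<lambda>_. False"] by (auto simp: trivial_limit_def)
  moreover have "U \<le> sequentially"
    unfolding le_filter_def
    by (auto simp: ev eventually_sequentially intro: up[OF tails])
  moreover have "eventually P U \<or> eventually (\<lambda>m. \<not> P m) U" for P
    using ultra[of "Collect P"] by (simp add: ev Collect_neg_eq)
  ultimately show ?thesis by blast
qed

text \<open>Coordinatewise choice of a witness or a counterexample. Staying below \<open>t\<close>
  even where there is none keeps \<open>f\<close> in every initial segment that contains
  \<open>t\<close>.\<close>

lemma ex_bounded_choice:
  fixes t :: "'i \<Rightarrow> nat"
  shows "\<exists>f. (\<forall>m. f m \<le> t m) \<and> (\<forall>m. (\<exists>x\<le>t m. P m x) \<longrightarrow> P m (f m))"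
proof -
  have "\<forall>m. \<exists>z. z \<le> t m \<and> ((\<exists>x\<le>t m. P m x) \<longrightarrow> P m z)" by blast
  then show ?thesis by (metis (mono_tags, lifting))
qed

text \<open>Elements of the model are sequences of natural numbers modulo the ultrafilter \<open>U\<close>; since
  equality is not a logical symbol, the quotient need not be formed. The domain \<open>D\<close> is an initial
  segment of the ultrapower, closed under the operations, and semiregular for bounded formulas.\<close>

locale semiregular_cut =
  fixes U :: "nat filter" and D :: "(nat \<Rightarrow> nat) set"
  assumes proper: "U \<noteq> bot"
    and ultra: "\<And>P. eventually P U \<or> eventually (\<lambda>m. \<not> P m) U"
    and nonempty: "D \<noteq> {}"
    and downward: "\<And>f g. f \<in> D \<Longrightarrow> eventually (\<lambda>m. g m \<le> f m) U \<Longrightarrow> g \<in> D"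
    and Suc_closed: "\<And>f. f \<in> D \<Longrightarrow> (\<lambda>m. Suc (f m)) \<in> D"
    and plus_closed: "\<And>f g. f \<in> D \<Longrightarrow> g \<in> D \<Longrightarrow> (\<lambda>m. f m + g m) \<in> D"
    and times_closed: "\<And>f g. f \<in> D \<Longrightarrow> g \<in> D \<Longrightarrow> (\<lambda>m. f m * g m) \<in> D"
    and semiregular: "\<And>\<theta> e f. bounded_fm \<theta> \<Longrightarrow> \<forall>i. e i \<in> D \<Longrightarrow> f \<in> D \<Longrightarrow>
      \<exists>h\<in>D. \<forall>g y. eventually (\<lambda>m. g m \<le> f m) U \<longrightarrow> y \<in> D \<longrightarrow>
        eventually (\<lambda>m. sat (y m ;; g m ;; (\<lambda>i. e i m)) \<theta>) U \<longrightarrow>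
        eventually (\<lambda>m. \<exists>y\<le>h m. sat (y ;; g m ;; (\<lambda>i. e i m)) \<theta>) U"
begin

text \<open>Atoms are evaluated in the ultrapower, but quantifiers range over \<open>D\<close> only;
  the agreement with coordinatewise truth is therefore shown for bounded formulas.\<close>

primrec isat :: "(nat \<Rightarrow> nat \<Rightarrow> nat) \<Rightarrow> fm \<Rightarrow> bool" where
  "isat e (Atom a) \<longleftrightarrow> eventually (\<lambda>m. sat_atm (\<lambda>i. e i m) a) U"
| "isat e (NegAtom a) \<longleftrightarrow> \<not> eventually (\<lambda>m. sat_atm (\<lambda>i. e i m) a) U"
| "isat e (And \<phi> \<psi>) \<longleftrightarrow> isat e \<phi> \<and> isat e \<psi>"
| "isat e (Or \<phi> \<psi>) \<longleftrightarrow> isat e \<phi> \<or> isat e \<psi>"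
| "isat e (Forall \<phi>) \<longleftrightarrow> (\<forall>f\<in>D. isat (f ;; e) \<phi>)"
| "isat e (Exists \<phi>) \<longleftrightarrow> (\<exists>f\<in>D. isat (f ;; e) \<phi>)"

definition envs :: "(nat \<Rightarrow> nat \<Rightarrow> nat) set" where
  "envs = {e. \<forall>i. e i \<in> D}"

text \<open>With \<open>eventually_disj_iff\<close>, the propositional cases of Los's theorem; the
  ultrafilter property enters here.\<close>

lemma eventually_not_iff: "eventually (\<lambda>m. \<not> P m) U \<longleftrightarrow> \<not> eventually P U"
  using ultra[of P] proper eventually_conj[of P U "\<lambda>m. \<not> P m"]
  by (auto simp: trivial_limit_def)

lemma eventually_disj_iff: "eventually (\<lambda>m. P m \<or> Q m) U \<longleftrightarrow> eventually P U \<or> eventually Q U"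
  using eventually_conj_iff[of "\<lambda>m. \<not> P m" "\<lambda>m. \<not> Q m" U]
    eventually_not_iff[of "\<lambda>m. P m \<or> Q m"] eventually_not_iff[of P] eventually_not_iff[of Q]
  by (simp add: de_Morgan_disj) blast

lemma zero_closed: "(\<lambda>_. 0) \<in> D"
  using nonempty downward[of _ "\<lambda>_. 0"] by auto

lemma le_closed: "f \<in> D \<Longrightarrow> (\<And>m. g m \<le> f m) \<Longrightarrow> g \<in> D"
  by (rule downward) auto

lemma scons_envs: "f \<in> D \<Longrightarrow> e \<in> envs \<Longrightarrow> f ;; e \<in> envs"
  by (auto simp: envs_def split: nat.split)

lemma scons_at: "(\<lambda>i. (f ;; e) i m) = (f m ;; (\<lambda>i. e i m))"
  by (auto split: nat.split)

section \<open>Substitution and soundness\<close>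

lemma val_closed: "e \<in> envs \<Longrightarrow> (\<lambda>m. val (\<lambda>i. e i m) t) \<in> D"
  by (induction t) (auto simp: envs_def zero_closed Suc_closed plus_closed times_closed)

lemma isat_neg: "isat e (neg \<phi>) \<longleftrightarrow> \<not> isat e \<phi>"
  by (induction \<phi> arbitrary: e) auto

lemma isat_subst: "isat e (subst \<sigma> \<phi>) \<longleftrightarrow> isat (\<lambda>i m. val (\<lambda>j. e j m) (\<sigma> i)) \<phi>"
proof (induction \<phi> arbitrary: e \<sigma>)
  case (Forall \<phi>)
  have "(\<lambda>i m. val (\<lambda>j. (f ;; e) j m) ((Var 0 ;; (\<lambda>i. lift_trm (\<sigma> i))) i)) =
      f ;; (\<lambda>i m. val (\<lambda>j. e j m) (\<sigma> i))" for f
    by (auto simp: fun_eq_iff val_subst_trm split: nat.split)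
  then show ?case by (simp add: Forall)
next
  case (Exists \<phi>)
  have "(\<lambda>i m. val (\<lambda>j. (f ;; e) j m) ((Var 0 ;; (\<lambda>i. lift_trm (\<sigma> i))) i)) =
      f ;; (\<lambda>i m. val (\<lambda>j. e j m) (\<sigma> i))" for f
    by (auto simp: fun_eq_iff val_subst_trm split: nat.split)
  then show ?case by (simp add: Exists)
qed (auto simp: sat_atm_subst_atm)

lemma isat_lift: "isat (f ;; e) (lift \<phi>) \<longleftrightarrow> isat e \<phi>"
  by (simp add: isat_subst)

lemma isat_subst_scons: "isat e (subst (t ;; Var) \<phi>) \<longleftrightarrow> isat ((\<lambda>m. val (\<lambda>i. e i m) t) ;; e) \<phi>"
proof -
  have "(\<lambda>i m. val (\<lambda>j. e j m) ((t ;; Var) i)) = (\<lambda>m. val (\<lambda>i. e i m) t) ;; e"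
    by (auto simp: fun_eq_iff split: nat.split)
  then show ?thesis by (simp add: isat_subst)
qed

text \<open>Induction on the derivation. An existential witness lies in \<open>D\<close> by
  \<open>val_closed\<close>, lifted side formulas do not see the eigenvariable, and a cut is
  resolved by \<open>isat_neg\<close>.\<close>

lemma isat_soundness:
  assumes "derivable T \<Gamma>" "\<And>\<phi> e. \<phi> \<in> T \<Longrightarrow> e \<in> envs \<Longrightarrow> isat e \<phi>" "e \<in> envs"
  shows "\<exists>\<phi>\<in>set \<Gamma>. isat e \<phi>"
  using assms(1,3)
proof (induction arbitrary: e rule: derivable.induct)
  case (Theory \<phi>)
  then show ?case using assms(2) by auto
next
  case (AllI \<phi> \<Gamma>)
  show ?case
  proof (cases "\<exists>\<psi>\<in>set \<Gamma>. isat e \<psi>")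
    case False
    then have "isat (f ;; e) \<phi>" if "f \<in> D" for f
      using AllI.IH[OF scons_envs[OF that AllI.prems]] by (auto simp: isat_lift)
    then show ?thesis by simp
  qed auto
next
  case (ExI t \<phi> \<Gamma>)
  show ?case
    using val_closed[OF ExI.prems, of t] ExI.IH[OF ExI.prems] by (auto simp: isat_subst_scons)
next
  case (Cut \<phi> \<Gamma>)
  show ?case using Cut.IH(1,2)[OF Cut.prems] by (auto simp: isat_neg)
next
  case (AndI \<phi> \<Gamma> \<psi>)
  show ?case using AndI.IH(1,2)[OF AndI.prems] by auto
next
  case (OrI \<phi> \<psi> \<Gamma>)
  show ?case using OrI.IH[OF OrI.prems] by auto
next
  case (Structural \<Gamma> \<Delta>)
  show ?case using Structural.IH[OF Structural.prems] Structural.hyps by blast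
qed simp

lemma isat_univ_closure:
  assumes "\<And>e. e \<in> envs \<Longrightarrow> isat e \<phi>" "e \<in> envs"
  shows "isat e (univ_closure \<phi>)"
proof -
  have "\<forall>e\<in>envs. isat e ((Forall ^^ n) \<phi>)" for n
    by (induction n) (auto simp: assms(1) scons_envs)
  then show ?thesis using assms(2) by (simp add: univ_closure_def)
qed

text \<open>Los's theorem. For a bounded quantifier, a coordinatewise witness or counterexample
  stays below the value of the bounding term and hence lies in \<open>D\<close>.\<close>

lemma isat_bounded_iff:
  assumes "bounded_fm \<theta>" "e \<in> envs"
  shows "isat e \<theta> \<longleftrightarrow> eventually (\<lambda>m. sat (\<lambda>i. e i m) \<theta>) U"
  using assms
proof (induction arbitrary: e rule: bounded_fm.induct)
  case (2 a)
  then show ?case by (simp add: eventually_not_iff)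
next
  case (3 \<phi> \<psi>)
  then show ?case by (simp add: eventually_conj_iff)
next
  case (4 \<phi> \<psi>)
  then show ?case by (simp add: eventually_disj_iff)
next
  case (5 \<phi> t)
  let ?t = "\<lambda>m. val (\<lambda>i. e i m) t"
  have "isat e (AllLe t \<phi>) \<longleftrightarrow> (\<forall>f\<in>D. eventually (\<lambda>m. f m \<le> ?t m) U \<longrightarrow>
      eventually (\<lambda>m. sat (f m ;; (\<lambda>i. e i m)) \<phi>) U)"
    using 5 by (auto simp: val_subst_trm scons_at scons_envs)
  also have "\<dots> \<longleftrightarrow> eventually (\<lambda>m. \<forall>x\<le>?t m. sat (x ;; (\<lambda>i. e i m)) \<phi>) U"
  proof
    assume all: "\<forall>f\<in>D. eventually (\<lambda>m. f m \<le> ?t m) U \<longrightarrow>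
      eventually (\<lambda>m. sat (f m ;; (\<lambda>i. e i m)) \<phi>) U"
    obtain f where f: "f m \<le> ?t m"
      "(\<exists>x\<le>?t m. \<not> sat (x ;; (\<lambda>i. e i m)) \<phi>) \<Longrightarrow> \<not> sat (f m ;; (\<lambda>i. e i m)) \<phi>" for m
      using ex_bounded_choice[of ?t "\<lambda>m x. \<not> sat (x ;; (\<lambda>i. e i m)) \<phi>"] by blast
    have "f \<in> D" by (rule le_closed[OF val_closed[OF 5(3)]]) (rule f)
    then have "eventually (\<lambda>m. sat (f m ;; (\<lambda>i. e i m)) \<phi>) U"
      using all f(1) by auto
    then show "eventually (\<lambda>m. \<forall>x\<le>?t m. sat (x ;; (\<lambda>i. e i m)) \<phi>) U"
      by (rule eventually_mono) (use f(2) in blast)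
  next
    assume all: "eventually (\<lambda>m. \<forall>x\<le>?t m. sat (x ;; (\<lambda>i. e i m)) \<phi>) U"
    show "\<forall>f\<in>D. eventually (\<lambda>m. f m \<le> ?t m) U \<longrightarrow>
      eventually (\<lambda>m. sat (f m ;; (\<lambda>i. e i m)) \<phi>) U"
    proof (intro ballI impI)
      fix f
      assume "eventually (\<lambda>m. f m \<le> ?t m) U"
      with all show "eventually (\<lambda>m. sat (f m ;; (\<lambda>i. e i m)) \<phi>) U"
        by eventually_elim blast
    qed
  qed
  finally show ?case by (simp add: val_subst_trm)
next
  case (6 \<phi> t)
  let ?t = "\<lambda>m. val (\<lambda>i. e i m) t"
  have "isat e (ExLe t \<phi>) \<longleftrightarrow> (\<exists>f\<in>D. eventually (\<lambda>m. f m \<le> ?t m) U \<and>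
      eventually (\<lambda>m. sat (f m ;; (\<lambda>i. e i m)) \<phi>) U)"
    using 6 by (auto simp: val_subst_trm scons_at scons_envs)
  also have "\<dots> \<longleftrightarrow> eventually (\<lambda>m. \<exists>x\<le>?t m. sat (x ;; (\<lambda>i. e i m)) \<phi>) U"
  proof
    assume "\<exists>f\<in>D. eventually (\<lambda>m. f m \<le> ?t m) U \<and>
      eventually (\<lambda>m. sat (f m ;; (\<lambda>i. e i m)) \<phi>) U"
    then obtain f where "eventually (\<lambda>m. f m \<le> ?t m) U"
      "eventually (\<lambda>m. sat (f m ;; (\<lambda>i. e i m)) \<phi>) U"
      by blast
    then show "eventually (\<lambda>m. \<exists>x\<le>?t m. sat (x ;; (\<lambda>i. e i m)) \<phi>) U"
      by eventually_elim blast
  next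
    assume ex: "eventually (\<lambda>m. \<exists>x\<le>?t m. sat (x ;; (\<lambda>i. e i m)) \<phi>) U"
    obtain f where f: "f m \<le> ?t m"
      "(\<exists>x\<le>?t m. sat (x ;; (\<lambda>i. e i m)) \<phi>) \<Longrightarrow> sat (f m ;; (\<lambda>i. e i m)) \<phi>" for m
      using ex_bounded_choice[of ?t "\<lambda>m x. sat (x ;; (\<lambda>i. e i m)) \<phi>"] by blast
    have "f \<in> D" by (rule le_closed[OF val_closed[OF 6(3)]]) (rule f)
    moreover have "eventually (\<lambda>m. sat (f m ;; (\<lambda>i. e i m)) \<phi>) U"
      using ex by (rule eventually_mono) (use f(2) in blast)
    ultimately show "\<exists>f\<in>D. eventually (\<lambda>m. f m \<le> ?t m) U \<and>
      eventually (\<lambda>m. sat (f m ;; (\<lambda>i. e i m)) \<phi>) U"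
      using f(1) by (intro bexI[of _ f]) auto
  qed
  finally show ?case by (simp add: val_subst_trm)
qed simp

text \<open>One direction of Los's theorem survives unbounded existential quantifiers: a witness in
  \<open>D\<close> is a witness in almost every coordinate, while coordinatewise witnesses might lie
  above \<open>D\<close>.\<close>

lemma isat_sigma_persistent:
  assumes "sigma_fm \<phi>" "e \<in> envs" "isat e \<phi>"
  shows "eventually (\<lambda>m. sat (\<lambda>i. e i m) \<phi>) U"
  using assms
proof (induction arbitrary: e rule: sigma_fm.induct)
  case (2 a)
  then show ?case by (simp add: eventually_not_iff)
next
  case (3 \<phi> \<psi>)
  then show ?case by (simp add: eventually_conj_iff)
next
  case (4 \<phi> \<psi>)
  then show ?case by (auto simp: eventually_disj_iff)
next
  case (5 \<phi> t)
  let ?t = "\<lambda>m. val (\<lambda>i. e i m) t"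
  obtain f where f: "f m \<le> ?t m"
    "(\<exists>x\<le>?t m. \<not> sat (x ;; (\<lambda>i. e i m)) \<phi>) \<Longrightarrow> \<not> sat (f m ;; (\<lambda>i. e i m)) \<phi>" for m
    using ex_bounded_choice[of ?t "\<lambda>m x. \<not> sat (x ;; (\<lambda>i. e i m)) \<phi>"] by blast
  have "f \<in> D" by (rule le_closed[OF val_closed[OF 5(3)]]) (rule f)
  then have "isat (f ;; e) \<phi>"
    using 5(4) f(1) by (auto simp: val_subst_trm)
  then have "eventually (\<lambda>m. sat (f m ;; (\<lambda>i. e i m)) \<phi>) U"
    using 5(2)[OF scons_envs[OF \<open>f \<in> D\<close> 5(3)]] by (simp add: scons_at)
  then have "eventually (\<lambda>m. \<forall>x\<le>?t m. sat (x ;; (\<lambda>i. e i m)) \<phi>) U"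
    by (rule eventually_mono) (use f(2) in blast)
  then show ?case by (simp add: val_subst_trm)
next
  case (6 \<phi> t)
  then obtain f where f: "f \<in> D" "eventually (\<lambda>m. f m \<le> val (\<lambda>i. e i m) t) U" "isat (f ;; e) \<phi>"
    by (auto simp: val_subst_trm)
  have "eventually (\<lambda>m. sat (f m ;; (\<lambda>i. e i m)) \<phi>) U"
    using 6(2)[OF scons_envs[OF f(1) 6(3)] f(3)] by (simp add: scons_at)
  with f(2) show ?case by eventually_elim (auto simp: val_subst_trm)
next
  case (7 \<phi>)
  then obtain f where f: "f \<in> D" "isat (f ;; e) \<phi>" by auto
  have "eventually (\<lambda>m. sat (f m ;; (\<lambda>i. e i m)) \<phi>) U"
    using 7(2)[OF scons_envs[OF f(1) 7(3)] f(2)] by (simp add: scons_at)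
  then show ?case by eventually_elim auto
qed simp

text \<open>Semiregularity gives a single bound \<open>h\<close> for the witnesses at all arguments
  up to \<open>f\<close>. There the formula becomes the coordinatewise predicate \<open>Q\<close>,
  and the least number principle in each coordinate refutes the induction step.\<close>

lemma isat_induction_fm:
  assumes "sigma1_fm \<phi>" "e \<in> envs"
  shows "isat e (induction_fm \<phi>)"
proof -
  obtain \<theta> where \<theta>: "bounded_fm \<theta>" "\<phi> = Exists \<theta>"
    using assms(1) by (auto simp: sigma1_fm_def)
  let ?e = "\<lambda>m i. e i m"
  have isat_iff: "isat (g ;; e) \<phi> \<longleftrightarrow> (\<exists>y\<in>D. eventually (\<lambda>m. sat (y m ;; g m ;; ?e m) \<theta>) U)"
    if "g \<in> D" for g
    using that assms(2) by (simp add: \<theta> isat_bounded_iff scons_envs scons_at)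
  have "isat (f ;; e) \<phi>" if f: "f \<in> D" and zero: "isat ((\<lambda>_. 0) ;; e) \<phi>"
    and step: "\<And>g. g \<in> D \<Longrightarrow> isat (g ;; e) \<phi> \<Longrightarrow> isat ((\<lambda>m. Suc (g m)) ;; e) \<phi>" for f
  proof (rule ccontr)
    assume neg: "\<not> isat (f ;; e) \<phi>"
    obtain h where h: "h \<in> D" "\<And>g y. eventually (\<lambda>m. g m \<le> f m) U \<Longrightarrow> y \<in> D \<Longrightarrow>
        eventually (\<lambda>m. sat (y m ;; g m ;; ?e m) \<theta>) U \<Longrightarrow>
        eventually (\<lambda>m. \<exists>y\<le>h m. sat (y ;; g m ;; ?e m) \<theta>) U"
      using semiregular[OF \<theta>(1) _ f, of e] assms(2) unfolding envs_def by blast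
    define Q where "Q m x \<longleftrightarrow> (\<exists>y\<le>h m. sat (y ;; x ;; ?e m) \<theta>)" for m x
    have Q_iff: "isat (g ;; e) \<phi> \<longleftrightarrow> eventually (\<lambda>m. Q m (g m)) U"
      if g: "eventually (\<lambda>m. g m \<le> f m) U" for g
    proof
      have "g \<in> D" using f g by (rule downward)
      {
        assume "isat (g ;; e) \<phi>"
        then show "eventually (\<lambda>m. Q m (g m)) U"
          using isat_iff[OF \<open>g \<in> D\<close>] h(2)[OF g] by (auto simp: Q_def)
      }
      assume ev: "eventually (\<lambda>m. Q m (g m)) U"
      \<comment> \<open>A witness chosen below \<open>h\<close> lies in \<open>D\<close>.\<close>
      obtain y where y: "y m \<le> h m" "Q m (g m) \<Longrightarrow> sat (y m ;; g m ;; ?e m) \<theta>" for m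
        using ex_bounded_choice[of h "\<lambda>m y. sat (y ;; g m ;; ?e m) \<theta>"] unfolding Q_def by blast
      have "y \<in> D" using h(1) y(1) by (rule le_closed)
      moreover have "eventually (\<lambda>m. sat (y m ;; g m ;; ?e m) \<theta>) U"
        using ev by (rule eventually_mono) (rule y(2))
      ultimately show "isat (g ;; e) \<phi>" using isat_iff[OF \<open>g \<in> D\<close>] by blast
    qed
    have ev0: "eventually (\<lambda>m. Q m 0) U"
      using zero Q_iff[of "\<lambda>_. 0"] by simp
    have evf: "eventually (\<lambda>m. \<not> Q m (f m)) U"
      using neg Q_iff[of f] by (simp add: eventually_not_iff)
    have jump: "\<exists>x<f m. Q m x \<and> \<not> Q m (Suc x)" if "Q m 0" "\<not> Q m (f m)" for m
      using ex_least_nat_less[of "\<lambda>x. \<not> Q m x" "f m"] that by auto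
    \<comment> \<open>\<open>g m\<close> is an argument right after which \<open>Q\<close> fails. It
      is specified only where \<open>Q m\<close> holds at 0 and fails at \<open>f m\<close>, which
      is almost everywhere.\<close>
    obtain g where g: "Q m 0 \<and> \<not> Q m (f m) \<Longrightarrow> g m < f m \<and> Q m (g m) \<and> \<not> Q m (Suc (g m))" for m
      using jump by metis
    have ev: "eventually (\<lambda>m. g m < f m \<and> Q m (g m) \<and> \<not> Q m (Suc (g m))) U"
      using ev0 evf by eventually_elim (use g in blast)
    have le: "eventually (\<lambda>m. g m \<le> f m) U" "eventually (\<lambda>m. Suc (g m) \<le> f m) U"
      and Qg: "eventually (\<lambda>m. Q m (g m)) U" and nQ: "eventually (\<lambda>m. \<not> Q m (Suc (g m))) U"
      using ev by (auto elim: eventually_mono)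
    have "isat ((\<lambda>m. Suc (g m)) ;; e) \<phi>"
      using step[OF downward[OF f le(1)]] Q_iff[OF le(1)] Qg by blast
    then show False
      using Q_iff[OF le(2)] nQ by (simp add: eventually_not_iff)
  qed
  moreover have "isat e (subst (Zero ;; Var) \<phi>) \<longleftrightarrow> isat ((\<lambda>_. 0) ;; e) \<phi>"
    by (simp add: isat_subst_scons)
  moreover have "isat (g ;; e) (subst (Succ (Var 0) ;; (\<lambda>i. Var (Suc i))) \<phi>) \<longleftrightarrow>
      isat ((\<lambda>m. Suc (g m)) ;; e) \<phi>" for g
  proof -
    have "(\<lambda>i m. val (\<lambda>j. (g ;; e) j m) ((Succ (Var 0) ;; (\<lambda>i. Var (Suc i))) i)) =
        (\<lambda>m. Suc (g m)) ;; e"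
      by (auto simp: fun_eq_iff split: nat.split)
    then show ?thesis by (simp add: isat_subst)
  qed
  ultimately show ?thesis
    by (auto simp: induction_fm_def isat_neg simp del: subst.simps)
qed

section \<open>The axioms of Robinson arithmetic in the cut\<close>

lemma isat_univ_closure_bounded:
  assumes "bounded_fm \<theta>" "\<And>e. sat e \<theta>" "e \<in> envs"
  shows "isat e (univ_closure \<theta>)"
proof (rule isat_univ_closure)
  show "isat e \<theta>" if "e \<in> envs" for e
    unfolding isat_bounded_iff[OF assms(1) that] by (simp add: assms(2))
qed (rule assms(3))

text \<open>This axiom and the one in \<open>isat_le_iff_plus\<close> demand witnesses in
  \<open>D\<close>. The predecessor and the truncated difference lie below elements of
  \<open>D\<close>.\<close>

lemma isat_nonzero_iff_Suc:
  assumes "e \<in> envs"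
  shows "isat e (Iff (neg (Var 0 \<doteq> Zero)) (Exists (Var 1 \<doteq> Succ (Var 0))))"
proof -
  have "e 0 \<in> D" using assms by (simp add: envs_def)
  then have D: "(\<lambda>m. e 0 m - 1) \<in> D" by (rule le_closed) simp
  have 1: "eventually (\<lambda>m. e 0 m = Suc (e 0 m - 1)) U" if "\<not> eventually (\<lambda>m. e 0 m = 0) U"
    using that unfolding eventually_not_iff[symmetric] by (rule eventually_mono) simp
  have 2: "\<not> eventually (\<lambda>m. e 0 m = 0) U" if "eventually (\<lambda>m. e 0 m = Suc (f m)) U" for f
    using that unfolding eventually_not_iff[symmetric] by (rule eventually_mono) simp
  show ?thesis
    using bexI[where P = "\<lambda>f. eventually (\<lambda>m. e 0 m = Suc (f m)) U", OF 1 D] 2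
    by (auto simp: isat_neg)
qed

lemma isat_le_iff_plus:
  assumes "e \<in> envs"
  shows "isat e (Iff (Var 0 \<preceq> Var 1) (Exists (Plus (Var 0) (Var 1) \<doteq> Var 2)))"
proof -
  have "e 1 \<in> D" using assms by (simp add: envs_def)
  then have D: "(\<lambda>m. e 1 m - e 0 m) \<in> D" by (rule le_closed) simp
  have 1: "eventually (\<lambda>m. e 1 m - e 0 m + e 0 m = e 1 m) U"
    if "eventually (\<lambda>m. e 0 m \<le> e 1 m) U"
    using that by (rule eventually_mono) simp
  have 2: "eventually (\<lambda>m. e 0 m \<le> e 1 m) U"
    if "eventually (\<lambda>m. f m + e 0 m = e 1 m) U" for f
    using that by (rule eventually_mono) auto
  show ?thesis
    using bexI[where P = "\<lambda>f. eventually (\<lambda>m. f m + e 0 m = e 1 m) U", OF 1 D] 2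
    by (auto simp: isat_neg eval_nat_numeral)
qed

lemma isat_robinson_axioms:
  assumes "\<phi> \<in> robinson_axioms" "e \<in> envs"
  shows "isat e \<phi>"
proof -
  \<comment> \<open>The axioms without an existential quantifier are closures of quantifier-free
    formulas that are true under every assignment.\<close>
  have bounded: "isat e \<phi>" if "\<phi> = univ_closure \<theta>" "bounded_fm \<theta>" "\<And>e. sat e \<theta>" for \<theta>
    using isat_univ_closure_bounded[OF that(2,3) assms(2)] that(1) by simp
  have closure: "isat e \<phi>" if "\<phi> = univ_closure \<psi>" "\<And>e. e \<in> envs \<Longrightarrow> isat e \<psi>" for \<psi>
    using isat_univ_closure[OF that(2) assms(2)] that(1) by simp
  have "\<phi> \<in> robinson_axioms \<Longrightarrow> isat e \<phi>"
    unfolding robinson_axioms_def equality_axioms_def image_insert image_empty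
    by (elim UnE insertE emptyE;
        (erule closure, rule isat_nonzero_iff_Suc isat_le_iff_plus, assumption |
         erule bounded))
     (auto simp: eval_nat_numeral intro: bounded_fm.intros)
  then show ?thesis using assms(1) .
qed

lemma isat_ISigma1: "\<phi> \<in> ISigma1 \<Longrightarrow> e \<in> envs \<Longrightarrow> isat e \<phi>"
  unfolding ISigma1_def
proof (elim UnE CollectE exE conjE)
  fix \<psi>
  assume "\<phi> = univ_closure (induction_fm \<psi>)" "sigma1_fm \<psi>" "e \<in> envs"
  then show "isat e \<phi>" using isat_univ_closure[OF isat_induction_fm] by simp
qed (rule isat_robinson_axioms)

end

section \<open>Unprovability\<close>

theorem theorem4p2p22:
  fixes \<phi> :: fm
  assumes "sigma_fm \<phi>"
    and "level \<phi> \<le> 3"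
    and "\<And>i k n :: nat. goodstein n i = k \<longleftrightarrow> sat (n ;; i ;; k ;; (\<lambda>_. 0)) \<phi>"
  shows "\<not> ISigma1 \<turnstile> Forall (Exists (subst (Var 1 ;; Var 0 ;; Zero ;; Var) \<phi>))"
proof
  assume provable: "ISigma1 \<turnstile> Forall (Exists (subst (Var 1 ;; Var 0 ;; Zero ;; Var) \<phi>))"
  obtain k s where s: "\<And>m. mono (s m)" "\<And>m. 3 * 2 ^ k m \<le> s m 0" "\<And>m. s m m \<le> ack (Suc (k m)) 2"
    "\<And>m i. i < m \<Longrightarrow> Suc (s m i) * Suc (s m i) \<le> s m (Suc i)"
    "\<And>m i \<theta> e. i < m \<Longrightarrow> to_nat \<theta> < m \<Longrightarrow> \<forall>l. e l \<le> s m i \<Longrightarrow> \<forall>l\<ge>level \<theta>. e l = 0 \<Longrightarrow>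
      \<exists>y\<le>s m m. sat (y ;; e) \<theta> \<Longrightarrow> \<exists>y\<le>s m (Suc i). sat (y ;; e) \<theta>"
    using ex_approximation by metis
  obtain U :: "nat filter" where U: "U \<noteq> bot" "U \<le> sequentially"
    "\<And>P. eventually P U \<or> eventually (\<lambda>m. \<not> P m) U"
    using ex_free_ultrafilter by blast
  have ev_gt: "eventually (\<lambda>m. n < m) U" for n
    using U(2) eventually_gt_at_top by (rule filter_leD)
  \<comment> \<open>\<open>n\<close> is fixed while the chain in coordinate \<open>m\<close> has
    \<open>m\<close> steps, so the top \<open>s m m\<close> bounds every element of \<open>D\<close>
    almost everywhere.\<close>
  define D where "D = {f. \<exists>n. eventually (\<lambda>m. f m \<le> s m n) U}"
  have D_I: "f \<in> D" if "\<And>m. f m \<le> s m n" for f n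
    unfolding D_def using that by (auto intro!: exI[of _ n])
  have D_pair: "\<exists>n. eventually (\<lambda>m. f m \<le> s m n \<and> g m \<le> s m n \<and> Suc (s m n) * Suc (s m n) \<le> s m (Suc n)) U"
    if fg: "f \<in> D" "g \<in> D" for f g
  proof -
    obtain n n' where "eventually (\<lambda>m. f m \<le> s m n) U" "eventually (\<lambda>m. g m \<le> s m n') U"
      using fg unfolding D_def by blast
    then have "eventually (\<lambda>m. f m \<le> s m (max n n') \<and> g m \<le> s m (max n n') \<and>
        Suc (s m (max n n')) * Suc (s m (max n n')) \<le> s m (Suc (max n n'))) U"
      using ev_gt[of "max n n'"]
    proof eventually_elim
      case (elim m)
      have "s m n \<le> s m (max n n')" "s m n' \<le> s m (max n n')"
        using s(1)[of m] by (simp_all add: monoD)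
      then show ?case using elim s(4)[of "max n n'" m] by simp
    qed
    then show ?thesis by blast
  qed
  interpret semiregular_cut U D
  proof
    show "U \<noteq> bot" by (rule U(1))
    show "eventually P U \<or> eventually (\<lambda>m. \<not> P m) U" for P by (rule U(3))
    have "(\<lambda>m. s m 0) \<in> D" by (rule D_I) (rule order_refl)
    then show "D \<noteq> {}" by blast
    show "g \<in> D" if fg: "f \<in> D" "eventually (\<lambda>m. g m \<le> f m) U" for f g
    proof -
      obtain n where "eventually (\<lambda>m. f m \<le> s m n) U" using fg(1) by (auto simp: D_def)
      with fg(2) have "eventually (\<lambda>m. g m \<le> s m n) U" by eventually_elim simp
      then show ?thesis by (auto simp: D_def)
    qed
    \<comment> \<open>All three operations are bounded by \<open>Suc z * Suc z\<close> on arguments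
      up to \<open>z\<close>, so one step along the chain absorbs them.\<close>
    have closed: "(\<lambda>m. op (f m) (g m)) \<in> D"
      if fg: "f \<in> D" "g \<in> D" and le: "\<And>x y z. x \<le> z \<Longrightarrow> y \<le> z \<Longrightarrow> op x y \<le> Suc z * Suc z" for f g op
    proof -
      obtain n where "eventually (\<lambda>m. f m \<le> s m n \<and> g m \<le> s m n \<and>
          Suc (s m n) * Suc (s m n) \<le> s m (Suc n)) U"
        using D_pair[OF fg] by blast
      then have "eventually (\<lambda>m. op (f m) (g m) \<le> s m (Suc n)) U"
        by eventually_elim (meson le le_trans)
      then show ?thesis by (auto simp: D_def)
    qed
    show "(\<lambda>m. Suc (f m)) \<in> D" if "f \<in> D" for f
      using that that by (rule closed[of f f "\<lambda>x _. Suc x"]) simp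
    show "(\<lambda>m. f m + g m) \<in> D" if "f \<in> D" "g \<in> D" for f g
      using that by (rule closed) simp
    show "(\<lambda>m. f m * g m) \<in> D" if "f \<in> D" "g \<in> D" for f g
      using that by (rule closed) (intro mult_le_mono; simp)
    fix \<theta> and e :: "nat \<Rightarrow> nat \<Rightarrow> nat" and f
    assume e: "\<forall>i. e i \<in> D" and f: "f \<in> D"
    \<comment> \<open>Only finitely many parameters occur in the formula, so one chain index bounds
      them all.\<close>
    have "\<exists>n. eventually (\<lambda>m. f m \<le> s m n \<and> (\<forall>i<L. e i m \<le> s m n)) U" for L
    proof (induction L)
      case 0
      then show ?case using f by (auto simp: D_def)
    next
      case (Suc L)
      then obtain n where n: "eventually (\<lambda>m. f m \<le> s m n \<and> (\<forall>i<L. e i m \<le> s m n)) U" by blast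
      obtain n' where "eventually (\<lambda>m. e L m \<le> s m n') U" using e by (auto simp: D_def)
      with n have "eventually (\<lambda>m. f m \<le> s m (max n n') \<and> (\<forall>i<Suc L. e i m \<le> s m (max n n'))) U"
      proof eventually_elim
        case (elim m)
        have "s m n \<le> s m (max n n')" "s m n' \<le> s m (max n n')"
          using s(1)[of m] by (simp_all add: monoD)
        then show ?case using elim by (auto simp: less_Suc_eq intro: order_trans)
      qed
      then show ?case by blast
    qed
    then obtain n where n: "eventually (\<lambda>m. f m \<le> s m n \<and> (\<forall>i<level \<theta>. e i m \<le> s m n)) U"
      by blast
    have "eventually (\<lambda>m. \<exists>y\<le>s m (Suc n). sat (y ;; g m ;; (\<lambda>i. e i m)) \<theta>) U"
      if g: "eventually (\<lambda>m. g m \<le> f m) U" and "y \<in> D"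
        and y: "eventually (\<lambda>m. sat (y m ;; g m ;; (\<lambda>i. e i m)) \<theta>) U" for g y
    proof -
      obtain n' where "eventually (\<lambda>m. y m \<le> s m n') U" using \<open>y \<in> D\<close> by (auto simp: D_def)
      \<comment> \<open>Beyond these three numbers the formula is among those treated in coordinate
        \<open>m\<close>, and \<open>y m\<close> is below \<open>s m m\<close>; the gap property
        then moves the witness below \<open>s m (Suc n)\<close>.\<close>
      with n g y ev_gt[of "max n (max n' (to_nat \<theta>))"] show ?thesis
      proof eventually_elim
        case (elim m)
        \<comment> \<open>The gap property is stated for assignments that vanish from the level of
          the formula on.\<close>
        define e' where "e' i = (if i < level \<theta> then (g m ;; (\<lambda>i. e i m)) i else 0)" for i
        have sat_iff: "sat (z ;; e') \<theta> \<longleftrightarrow> sat (z ;; g m ;; (\<lambda>i. e i m)) \<theta>" for z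
          by (rule sat_cong) (auto simp: e'_def split: nat.split)
        have "y m \<le> s m m" using elim s(1)[of m, THEN monoD, of n' m] by simp
        then have "\<exists>z\<le>s m m. sat (z ;; e') \<theta>" using elim sat_iff by blast
        moreover have "\<forall>l. e' l \<le> s m n" using elim by (auto simp: e'_def split: nat.split)
        moreover have "\<forall>l\<ge>level \<theta>. e' l = 0" by (simp add: e'_def)
        ultimately have "\<exists>z\<le>s m (Suc n). sat (z ;; e') \<theta>" using elim s(5)[of n m \<theta> e'] by simp
        then show ?case by (simp add: sat_iff)
      qed
    qed
    moreover have "(\<lambda>m. s m (Suc n)) \<in> D" by (rule D_I) (rule order_refl)
    ultimately show "\<exists>h\<in>D. \<forall>g y. eventually (\<lambda>m. g m \<le> f m) U \<longrightarrow> y \<in> D \<longrightarrow>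
        eventually (\<lambda>m. sat (y m ;; g m ;; (\<lambda>i. e i m)) \<theta>) U \<longrightarrow>
        eventually (\<lambda>m. \<exists>y\<le>h m. sat (y ;; g m ;; (\<lambda>i. e i m)) \<theta>) U"
      by (intro bexI[of _ "\<lambda>m. s m (Suc n)"]) auto
  qed
  \<comment> \<open>The exponent matches the ceiling \<open>ack (Suc (k m)) 2\<close>. The value is
    twice \<open>3 * 2 ^ k m\<close>, hence still in \<open>D\<close>.\<close>
  define start :: "nat \<Rightarrow> nat" where "start m = 3 * 2 ^ Suc (k m)" for m
  have "(\<lambda>m. 3 * 2 ^ k m) \<in> D" by (rule D_I) (rule s(2))
  from plus_closed[OF this this] have "start \<in> D" by (simp add: start_def[abs_def])
  have zero: "(\<lambda>_ _. 0) \<in> envs" by (simp add: envs_def zero_closed)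
  have "isat (\<lambda>_ _. 0) (Forall (Exists (subst (Var 1 ;; Var 0 ;; Zero ;; Var) \<phi>)))"
    using isat_soundness[OF provable[unfolded proves_def] isat_ISigma1 zero] by simp
  then obtain y where y: "y \<in> D"
    "isat (y ;; start ;; (\<lambda>_ _. 0)) (subst (Var 1 ;; Var 0 ;; Zero ;; Var) \<phi>)"
    using \<open>start \<in> D\<close> by auto
  \<comment> \<open>The substitution puts \<open>start\<close>, \<open>y\<close> and 0 in the first
    three places; its tail \<open>Var\<close> repeats the assignment from \<open>y\<close>
    on.\<close>
  define e where "e = start ;; y ;; (\<lambda>_. 0) ;; y ;; start ;; (\<lambda>_ _. 0)"
  have "(\<lambda>i m. val (\<lambda>j. (y ;; start ;; (\<lambda>_ _. 0)) j m) ((Var 1 ;; Var 0 ;; Zero ;; Var) i)) = e"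
    by (auto simp: fun_eq_iff e_def split: nat.split)
  then have "isat e \<phi>" using y(2) unfolding isat_subst by (simp only:)
  moreover have "e \<in> envs"
    unfolding e_def using y(1) \<open>start \<in> D\<close> zero by (intro scons_envs zero_closed)
  ultimately have "eventually (\<lambda>m. sat (\<lambda>i. e i m) \<phi>) U"
    using assms(1) isat_sigma_persistent by blast
  moreover have "sat (\<lambda>i. e i m) \<phi> \<longleftrightarrow> goodstein (start m) (y m) = 0" for m
  proof -
    have "sat (\<lambda>i. e i m) \<phi> \<longleftrightarrow> sat (start m ;; y m ;; 0 ;; (\<lambda>_. 0)) \<phi>"
    proof (rule sat_cong)
      fix i
      assume "i < level \<phi>"
      then have "i = 0 \<or> i = 1 \<or> i = 2" using assms(2) by linarith
      then show "e i m = (start m ;; y m ;; 0 ;; (\<lambda>_. 0)) i"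
        by (auto simp: e_def numeral_2_eq_2)
    qed
    then show ?thesis using assms(3) by simp
  qed
  ultimately have ev: "eventually (\<lambda>m. goodstein (start m) (y m) = 0) U" by simp
  obtain n where "eventually (\<lambda>m. y m \<le> s m n) U" using y(1) by (auto simp: D_def)
  with ev ev_gt[of n] have "eventually (\<lambda>m. False) U"
  proof eventually_elim
    case (elim m)
    have "ack (Suc (k m)) 2 \<le> y m + 2"
      using elim(1) unfolding start_def by (rule goodstein_zero_bound)
    moreover have "s m (Suc n) \<le> s m m" using s(1) elim(2) by (simp add: monoD)
    moreover have "3 \<le> s m n"
      using s(2)[of m] s(1)[of m, THEN monoD, of 0 n] by (simp add: le_trans[of 3 "3 * 2 ^ k m"])
    \<comment> \<open>The offset 2 between index and base is absorbed: \<open>y m + 2\<close> is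
      smaller than this square, which is at most \<open>s m (Suc n)\<close> and so at most
      \<open>ack (Suc (k m)) 2\<close>.\<close>
    then have "3 * s m n + 1 \<le> Suc (s m n) * Suc (s m n)" by simp
    ultimately show False
      using s(3)[of m] s(4)[of n m] elim \<open>3 \<le> s m n\<close> by linarith
  qed
  then show False using U(1) by (simp add: trivial_limit_def)
qed

end
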